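(* Fix $q\in[0,1)$. Let $(\Pi_n)_{n\in\mathbb{N}}$ be coupled through the infinite Bernoulli model (so each $\Pi_n$ is $\pi_{n,q}$-distributed). Let $d_n$ be the graph distance on $\mathrm{BST}(\Pi_n)$ and $\mu_n$ the uniform probability measure on its nodes. Then $$d_{\mathrm{GHP}}\Big(\big(\mathrm{BST}(\Pi_n),((1-q)n)^{-1}d_n,\mu_n\big),\ \big([0,1],|\cdot-\cdot|,\mathrm{Leb}_{[0,1]}\big)\Big)\longrightarrow0\quad\text{almost surely},$$ where $\mathrm{Leb}_{[0,1]}$ is the uniform (Lebesgue) measure on $[0,1]$.
   Context: $\pi_{n,q}(\sigma)=q^{\mathrm{Inv}(\sigma)}/Z_{n,q}$ on $S_n$, $\mathrm{Inv}(\sigma)=|\{i<j:\sigma(i)>\sigma(j)\}|$, $0^0=1$. Infinite Bernoulli model: $(B_{i,j})_{i,j\ge1}$ independent Bernoulli$(1-q)$, $I_i=\min\{j\notin\{I_1,\dots,I_{i-1}\}:B_{i,j}=1\}$, and $\Pi_n$ is the permutation of $\{1,\dots,n\}$ giving the relative order of $(I_1,\dots,I_n)$, i.e. $\Pi_n(i)=|\{j\le n:I_j\le I_i\}|$. $\mathbb{T}$ is the set of finite words over $\{0,1\}$ with root $\varnothing$ and edges $\{w,w0\},\{w,w1\}$; $aS=\{aw:w\in S\}$. For a finite sequence $x=(x_1,\dots,x_n)$ of distinct numbers, $\mathrm{BST}(x)=\emptyset$ if $n=0$, else $\{\varnothing\}\cup0\,\mathrm{BST}(x_-)\cup1\,\mathrm{BST}(x_+)$,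 $x_-$ (resp. $x_+$) being the subsequence of entries smaller (resp. larger) than $x_1$ in original order; $\mathrm{BST}(\sigma)=\mathrm{BST}(\sigma(1),\dots,\sigma(n))$. GHP distance: for weighted metric spaces $\mathcal{E}_i=(E_i,d_i,\mu_i)$ ($(E_i,d_i)$ compact, $\mu_i$ Borel probability), a correspondence is $C\subseteq E_1\times E_2$ whose projections are $E_1$ and $E_2$, with distortion $\mathrm{dis}(C)=\sup\{|d_1(x_1,x_1')-d_2(x_2,x_2')|:(x_1,x_2),(x_1',x_2')\in C\}$; a coupling is a probability measure $M$ on $E_1\times E_2$ with marginals $\mu_1,\mu_2$. $d_{\mathrm{GHP}}(\mathcal{E}_1,\mathcal{E}_2)=\inf\{\varepsilon>0:\exists (C,M),\ M(C)\ge1-\varepsilon,\ \mathrm{dis}(C)\le2\varepsilon\}$. *)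

theory Defs
  imports "HOL-Probability.Probability"
begin

text \<open>The random array (B i j), i,j >= 1, i.i.d. Bernoulli(1-q). We index by nat x nat
  and simply never use the entries with index 0.\<close>
definition bern_model :: "real \<Rightarrow> (nat \<times> nat \<Rightarrow> bool) measure" where
  "bern_model q = (\<Pi>\<^sub>M ij\<in>(UNIV :: (nat \<times> nat) set). measure_pmf (bernoulli_pmf (1 - q)))"

fun Iseq :: "(nat \<times> nat \<Rightarrow> bool) \<Rightarrow> nat \<Rightarrow> nat list" where
  "Iseq B 0 = []"
| "Iseq B (Suc n) = Iseq B n @ [LEAST j. 1 \<le> j \<and> j \<notin> set (Iseq B n) \<and> B (Suc n, j)]"

definition Ival :: "(nat \<times> nat \<Rightarrow> bool) \<Rightarrow> nat \<Rightarrow> nat" where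
  "Ival B i = Iseq B i ! (i - 1)"

definition Perm_n :: "(nat \<times> nat \<Rightarrow> bool) \<Rightarrow> nat \<Rightarrow> nat \<Rightarrow> nat" where
  "Perm_n B n i = card {j \<in> {1..n}. Ival B j \<le> Ival B i}"

text \<open>Words over {0,1} are bool lists (False = 0, True = 1).\<close>
function bst :: "nat list \<Rightarrow> bool list set" where
  "bst [] = {}"
| "bst (x # xs) = {[]} \<union> (Cons False) ` bst (filter (\<lambda>y. y < x) xs)
                        \<union> (Cons True) ` bst (filter (\<lambda>y. x < y) xs)"
  by pat_completeness auto
termination
  by (relation "Wellfounded.measure length") (auto simp: le_imp_less_Suc)

definition bst_n :: "(nat \<times> nat \<Rightarrow> bool) \<Rightarrow> nat \<Rightarrow> bool list set" where
  "bst_n B n = bst (map (Perm_n B n) [1..<Suc n])"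

definition tree_adj :: "bool list set \<Rightarrow> bool list \<Rightarrow> bool list \<Rightarrow> bool" where
  "tree_adj S u v \<longleftrightarrow> u \<in> S \<and> v \<in> S \<and> (\<exists>b. v = u @ [b] \<or> u = v @ [b])"

definition graph_dist :: "bool list set \<Rightarrow> bool list \<Rightarrow> bool list \<Rightarrow> nat" where
  "graph_dist S u v = (LEAST k. (tree_adj S ^^ k) u v)"

definition is_correspondence :: "'a set \<Rightarrow> 'b set \<Rightarrow> ('a \<times> 'b) set \<Rightarrow> bool" where
  "is_correspondence E1 E2 C \<longleftrightarrow> C \<subseteq> E1 \<times> E2 \<and> fst ` C = E1 \<and> snd ` C = E2"

definition is_coupling :: "'a measure \<Rightarrow> 'b measure \<Rightarrow> ('a \<times> 'b) measure \<Rightarrow> bool" where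
  "is_coupling \<mu>1 \<mu>2 M \<longleftrightarrow> prob_space M \<and> sets M = sets (\<mu>1 \<Otimes>\<^sub>M \<mu>2)
      \<and> distr M \<mu>1 fst = \<mu>1 \<and> distr M \<mu>2 snd = \<mu>2"

definition distortion_le :: "('a \<Rightarrow> 'a \<Rightarrow> real) \<Rightarrow> ('b \<Rightarrow> 'b \<Rightarrow> real) \<Rightarrow> ('a \<times> 'b) set \<Rightarrow> real \<Rightarrow> bool" where
  "distortion_le d1 d2 C r \<longleftrightarrow>
     (\<forall>p\<in>C. \<forall>p'\<in>C. \<bar>d1 (fst p) (fst p') - d2 (snd p) (snd p')\<bar> \<le> r)"

definition d_GHP :: "'a set \<Rightarrow> ('a \<Rightarrow> 'a \<Rightarrow> real) \<Rightarrow> 'a measure \<Rightarrow>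
                     'b set \<Rightarrow> ('b \<Rightarrow> 'b \<Rightarrow> real) \<Rightarrow> 'b measure \<Rightarrow> real" where
  "d_GHP E1 d1 \<mu>1 E2 d2 \<mu>2 = Inf {\<epsilon>. \<epsilon> > 0 \<and> (\<exists>C M. is_correspondence E1 E2 C \<and> is_coupling \<mu>1 \<mu>2 M
       \<and> C \<in> sets M \<and> measure M C \<ge> 1 - \<epsilon> \<and> distortion_le d1 d2 C (2 * \<epsilon>))}"

end

theory Submission
  imports Defs
begin

text \<open>The rightmost path of the search tree consists of the records (left-to-right maxima) of
  \<open>I\<^sub>1, \<dots>, I\<^sub>n\<close>. A column \<open>m\<close> is a record value iff the entry in column \<open>m\<close> of the first row
  \<open>i\<close> with \<open>I\<^sub>i \<ge> m\<close> is one, and this row is determined by the columns before \<open>m\<close>; hence the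
  record indicators are independent Bernoulli(\<open>1 - q\<close>) variables and there are
  \<open>(1 - q) m + o(m)\<close> record values up to \<open>m\<close>. Moreover
  \<open>I\<^sub>n \<le> n - 1 + g\<close> outside an event of probability at most \<open>q\<^sup>g\<close>, so \<open>max {I\<^sub>i | i \<le> n} = n + o(n)\<close>
  and ranks agree with values up to \<open>o(n)\<close>. Thus the node of rank \<open>r\<close> hangs off the rightmost path at
  height \<open>(1 - q) r + o(n)\<close>, and the subtrees hanging off this path have size \<open>o(n)\<close>, because all their
  nodes share the same number of smaller records. So the tree is within \<open>o(n)\<close> of its rightmost
  path, and pairing \<open>x\<close> with the node of rank \<open>\<lceil>n x\<rceil>\<close> gives both the correspondence and
  the coupling.\<close>

section \<open>Search trees and records\<close>

text \<open>Address at which the search tree stores the key \<open>v\<close>. Indexing the nodes by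
  their keys turns statements about words into statements about ranks.\<close>

function node :: "nat list \<Rightarrow> nat \<Rightarrow> bool list" where
  "node [] v = []"
| "node (x # xs) v =
     (if v = x then []
      else if v < x then False # node (filter (\<lambda>y. y < x) xs) v
      else True # node (filter (\<lambda>y. x < y) xs) v)"
  by pat_completeness auto
termination
  by (relation "Wellfounded.measure (length \<circ> fst)") (auto simp: le_imp_less_Suc)

lemma bst_eq_node_image: "bst L = node L ` set L"
proof (induction L rule: bst.induct)
  case (2 x xs)
  show ?case
  proof (intro set_eqI iffI)
    fix w assume "w \<in> bst (x # xs)"
    then consider "w = []"
      | v where "v \<in> set xs" "v < x" "w = False # node (filter (\<lambda>y. y < x) xs) v"
      | v where "v \<in> set xs" "x < v" "w = True # node (filter (\<lambda>y. x < y) xs) v"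
      by (auto simp: 2)
    then show "w \<in> node (x # xs) ` set (x # xs)"
      by cases (force intro: image_eqI[of _ _ x] image_eqI)+
  qed (auto simp: 2)
qed simp

lemma inj_on_node: "inj_on (node L) (set L)"
proof (induction L rule: bst.induct)
  case (2 x xs)
  show ?case
  proof (rule inj_onI)
    fix u v assume uv: "u \<in> set (x # xs)" "v \<in> set (x # xs)"
      and eq: "node (x # xs) u = node (x # xs) v"
    consider "u = x" "v = x" | "u < x" "v < x" | "x < u" "x < v"
      using eq by (auto split: if_splits)
    then show "u = v"
      by cases (use uv eq 2 in \<open>auto dest: inj_onD\<close>)
  qed
qed simp

text \<open>Each step down discards at least the pivot from the list of candidate keys.\<close>

lemma length_node_less: "v \<in> set L \<Longrightarrow> length (node L v) < length L"
proof (induction L rule: bst.induct)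
  case (2 x xs)
  have "length (filter P xs) \<le> length xs" for P :: "nat \<Rightarrow> bool"
    by simp
  then show ?case
    using 2 by (auto simp: less_Suc_eq_le intro: order.trans[OF Suc_leI])
qed simp

lemma bst_prefix: "a @ b \<in> bst L \<Longrightarrow> a \<in> bst L"
proof (induction L arbitrary: a rule: bst.induct)
  case (2 x xs)
  then show ?case
    by (cases a) auto
qed simp

text \<open>Left-to-right maxima, identified by value instead of position because the tree compares
  values.\<close>

definition is_record :: "nat list \<Rightarrow> nat \<Rightarrow> bool" where
  "is_record L l \<longleftrightarrow> l \<in> set L \<and> (\<forall>y\<in>set (takeWhile (\<lambda>z. z \<noteq> l) L). y < l)"

definition records_below :: "nat list \<Rightarrow> nat \<Rightarrow> nat" where
  "records_below L v = card {l. is_record L l \<and> l < v}"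

lemma takeWhile_neq_filter:
  "P l \<Longrightarrow> takeWhile (\<lambda>z. z \<noteq> l) (filter P xs) = filter P (takeWhile (\<lambda>z. z \<noteq> l) xs)"
  by (induction xs) auto

text \<open>Entries below the head are not records and do not prevent a later entry above
  \<open>x\<close> from being one. Hence the records obey the same recursion as the right spine of
  the tree.\<close>

lemma is_record_Cons:
  "is_record (x # xs) l \<longleftrightarrow> l = x \<or> x < l \<and> is_record (filter (\<lambda>y. x < y) xs) l"
proof (cases "x < l")
  case True
  then show ?thesis
    by (auto simp: is_record_def takeWhile_neq_filter[of "\<lambda>y. x < y"])
next
  case False
  then show ?thesis
    by (cases "l = x") (auto simp: is_record_def)
qed

lemma records_below_Cons:
  "records_below (x # xs) v =
     (if v \<le> x then 0 else Suc (records_below (filter (\<lambda>y. x < y) xs) v))"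
proof (cases "v \<le> x")
  case True
  then show ?thesis
    by (auto simp: records_below_def is_record_Cons)
next
  case False
  let ?R = "{l. is_record (filter (\<lambda>y. x < y) xs) l \<and> l < v}"
  have "{l. is_record (x # xs) l \<and> l < v} = insert x ?R"
    using False by (auto simp: is_record_Cons) (auto simp: is_record_def)
  moreover have "x \<notin> ?R" "finite ?R"
    by (auto simp: is_record_def)
  ultimately show ?thesis
    using False by (simp add: records_below_def)
qed

text \<open>The descent to \<open>v\<close> turns right at each record below \<open>v\<close>. Once
  it turns left, it enters a subtree whose keys all have the same number of smaller records as
  \<open>v\<close>, so the size of this class bounds the remaining depth.\<close>

lemma node_decomp:
  assumes "v \<in> set L" "distinct L"
  shows "\<exists>w. node L v = replicate (records_below L v) True @ w \<and>
           length w \<le> card {u \<in> set L. records_below L u = records_below L v}"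
  using assms
proof (induction L rule: bst.induct)
  case (2 x xs)
  let ?B = "\<lambda>L. {u \<in> set L. records_below L u = records_below L v}"
  consider "v = x" | "v < x" | "x < v" by linarith
  then show ?case
  proof cases
    case 2
    let ?ys = "filter (\<lambda>y. y < x) xs"
    have "length (node ?ys v) < length ?ys"
      using 2 "2.prems" by (intro length_node_less) auto
    \<comment> \<open>Distinctness turns the length of the list into a number of keys; none of them
      has a record below it.\<close>
    moreover have "length ?ys = card (set ?ys)"
      using "2.prems" by (intro distinct_card[symmetric]) auto
    moreover have "card (set ?ys) \<le> card (?B (x # xs))"
      using 2 by (intro card_mono) (auto simp: records_below_Cons)
    ultimately show ?thesis
      using 2 by (intro exI[of _ "False # node ?ys v"]) (auto simp: records_below_Cons)
  next
    case 3
    let ?ys = "filter (\<lambda>y. x < y) xs"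
    obtain w where w: "node ?ys v = replicate (records_below ?ys v) True @ w"
        "length w \<le> card (?B ?ys)"
      using "2.IH"(2) "2.prems" 3 by auto
    have "card (?B ?ys) \<le> card (?B (x # xs))"
      using 3 by (intro card_mono) (auto simp: records_below_Cons)
    with w 3 show ?thesis
      by (intro exI[of _ w]) (auto simp: records_below_Cons)
  qed (auto simp: records_below_Cons)
qed simp

section \<open>Distances in prefix-closed sets of words\<close>

lemma tree_path_append:
  assumes "\<And>a b. a @ b \<in> S \<Longrightarrow> a \<in> S" "a @ b \<in> S"
  shows "(tree_adj S ^^ length b) a (a @ b)" "(tree_adj S ^^ length b) (a @ b) a"
proof -
  have "(tree_adj S ^^ length b) a (a @ b) \<and> (tree_adj S ^^ length b) (a @ b) a"
    using assms(2)
  proof (induction b rule: rev_induct)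
    case (snoc x b)
    have "a @ b \<in> S"
      using snoc.prems assms(1)[of "a @ b" "[x]"] by simp
    with snoc have "tree_adj S (a @ b) (a @ b @ [x])" "tree_adj S (a @ b @ [x]) (a @ b)"
      by (auto simp: tree_adj_def)
    with snoc.IH[OF \<open>a @ b \<in> S\<close>] show ?case
      by (auto intro: relpowp_Suc_I relpowp_Suc_I2 simp del: relpowp.simps)
  qed simp
  then show "(tree_adj S ^^ length b) a (a @ b)" "(tree_adj S ^^ length b) (a @ b) a"
    by auto
qed

lemma tree_path_length:
  "(tree_adj S ^^ k) u v \<Longrightarrow> \<bar>int (length u) - int (length v)\<bar> \<le> int k"
proof (induction k arbitrary: v)
  case (Suc k)
  then obtain w where "(tree_adj S ^^ k) u w" "tree_adj S w v"
    by auto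
  then show ?case
    using Suc.IH[OF \<open>(tree_adj S ^^ k) u w\<close>] by (auto simp: tree_adj_def)
qed auto

lemma relpowp_transD: "(R ^^ m) x y \<Longrightarrow> (R ^^ n) y z \<Longrightarrow> (R ^^ (m + n)) x z"
  by (auto simp: relpowp_add)

text \<open>Compare the path through the two spine vertices with the difference of the depths.\<close>
lemma graph_dist_spine:
  assumes pre: "\<And>a b. a @ b \<in> S \<Longrightarrow> a \<in> S"
    and u: "replicate k True @ w \<in> S" and v: "replicate k' True @ w' \<in> S"
  shows "\<bar>real (graph_dist S (replicate k True @ w) (replicate k' True @ w')) - \<bar>real k - real k'\<bar>\<bar>
           \<le> real (length w) + real (length w')"
proof -
  let ?r = "\<lambda>k. replicate k True"
  let ?u = "?r k @ w" and ?v = "?r k' @ w'"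
  define d where "d = nat \<bar>int k - int k'\<bar>"
  have S: "?r k \<in> S" "?r k' \<in> S"
    using u v pre by auto
  have mid: "(tree_adj S ^^ d) (?r k) (?r k')"
  proof (cases "k \<le> k'")
    case True
    then have "?r k' = ?r k @ ?r d" "d = length (?r d)"
      by (auto simp: d_def replicate_add[symmetric])
    then show ?thesis
      using tree_path_append(1)[of S "?r k" "?r d"] pre S by auto
  next
    case False
    then have "?r k = ?r k' @ ?r d" "d = length (?r d)"
      by (auto simp: d_def replicate_add[symmetric])
    then show ?thesis
      using tree_path_append(2)[of S "?r k'" "?r d"] pre S by auto
  qed
  \<comment> \<open>Climb \<open>w\<close> to the spine, move along the spine, then descend
    \<open>w'\<close>.\<close>
  have path: "(tree_adj S ^^ (length w + d + length w')) ?u ?v"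
    using relpowp_transD[OF relpowp_transD[OF tree_path_append(2)[OF pre u] mid] tree_path_append(1)[OF pre v]]
    by auto
  have upper: "graph_dist S ?u ?v \<le> length w + d + length w'"
    unfolding graph_dist_def using path by (rule Least_le)
  \<comment> \<open>A path exists, so the \<open>LEAST\<close> is attained. Each edge changes the
    depth by one, so the difference of the depths gives the lower bound.\<close>
  have "(tree_adj S ^^ graph_dist S ?u ?v) ?u ?v"
    unfolding graph_dist_def using path by (rule LeastI)
  from tree_path_length[OF this] upper show ?thesis
    by (auto simp: d_def abs_if split: if_splits)
qed

section \<open>Coupling with the unit interval\<close>

lemma prob_space_unit_interval: "prob_space (restrict_space lborel {0..1::real})"
  by (rule prob_spaceI) (simp add: space_restrict_space emeasure_restrict_space)

text \<open>For \<open>x\<close> in the unit interval and \<open>0 < n\<close>, the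
  \<open>max 1\<close> only matters at \<open>x = 0\<close>, where the ceiling is 0. So the first
  cell is closed on the left and all others are half-open.\<close>

definition cell :: "nat \<Rightarrow> real \<Rightarrow> nat" where
  "cell n x = max 1 (nat \<lceil>real n * x\<rceil>)"

lemma cell_range:
  assumes "0 < n" "x \<in> {0..1}"
  shows "cell n x \<in> {1..n}"
proof -
  have "real n * x \<le> real n"
    using assms by (auto simp: mult_left_le)
  then have "\<lceil>real n * x\<rceil> \<le> int n"
    by (simp add: ceiling_le_iff)
  then show ?thesis
    using assms by (auto simp: cell_def)
qed

lemma cell_approx:
  assumes "0 < n" "x \<in> {0..1}"
  shows "\<bar>x - real (cell n x) / real n\<bar> \<le> 1 / real n"
proof -
  have nx: "0 \<le> real n * x"
    using assms by auto
  have "\<bar>real n * x - real (cell n x)\<bar> \<le> 1"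
  proof (cases "\<lceil>real n * x\<rceil> \<le> 0")
    case True
    with nx have "real n * x = 0" by (simp add: ceiling_le_iff)
    then show ?thesis
      using True by (simp add: cell_def)
  next
    case False
    then have "real (cell n x) = of_int \<lceil>real n * x\<rceil>"
      by (auto simp: cell_def max_def simp del: ceiling_le_zero)
    then show ?thesis
      using ceiling_correct[of "real n * x"] by linarith
  qed
  then have "\<bar>real n * x - real (cell n x)\<bar> / real n \<le> 1 / real n"
    by (simp add: divide_right_mono)
  moreover have "\<bar>real n * x - real (cell n x)\<bar> / real n = \<bar>x - real (cell n x) / real n\<bar>"
    using assms(1) by (simp add: abs_if field_simps)
  ultimately show ?thesis by simp
qed

lemma cell_of_fraction: "0 < n \<Longrightarrow> k \<in> {1..n} \<Longrightarrow> cell n (real k / real n) = k"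
  by (auto simp: cell_def max_def)

lemma cell_preimage:
  assumes "0 < n" "k \<in> {1..n}"
  shows "{x \<in> {0..1}. cell n x = k} =
    (if k = 1 then {0..1 / real n} else {real (k - 1) / real n <.. real k / real n})"
proof -
  have c: "cell n x = k \<longleftrightarrow> (if k = 1 then real n * x \<le> 1 else real (k - 1) < real n * x \<and> real n * x \<le> real k)"
    if "x \<in> {0..1}" for x
  proof -
    have "0 \<le> real n * x" using that by simp
    then show ?thesis
      using assms by (auto simp: cell_def max_def nat_eq_iff ceiling_eq_iff ceiling_le_iff of_nat_diff
          split: if_splits) linarith+
  qed
  have nn: "0 \<le> x" if "real (k - 1) < real n * x" for x
  proof -
    have "0 < real n * x" using that by linarith
    then show ?thesis using assms(1) by (simp add: zero_less_mult_iff)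
  qed
  have le1: "x \<le> 1" if "real n * x \<le> real k" for x
  proof -
    have "real n * x \<le> real n" using assms(2) by (intro order.trans[OF that]) auto
    then show ?thesis using assms(1) by (simp add: mult_le_cancel_left1)
  qed
  show ?thesis
  proof (intro set_eqI)
    fix x
    show "x \<in> {x \<in> {0..1}. cell n x = k} \<longleftrightarrow>
      x \<in> (if k = 1 then {0..1 / real n} else {real (k - 1) / real n <.. real k / real n})"
    proof (cases "x \<in> {0..1}")
      case True
      then show ?thesis using c[OF True] assms(1) by (auto simp: field_simps)
    next
      case False
      then show ?thesis using nn[of x] le1[of x] assms by (auto simp: field_simps)
    qed
  qed
qed

lemma measurable_cell [measurable]: "cell n \<in> borel \<rightarrow>\<^sub>M count_space UNIV"
  unfolding cell_def by measurable

lemma emeasure_cell: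
  assumes "0 < n" "k \<in> {1..n}"
  shows "emeasure (restrict_space lborel {0..1::real}) {x \<in> {0..1}. cell n x = k} = ennreal (1 / real n)"
proof -
  have "emeasure (restrict_space lborel {0..1::real}) {x \<in> {0..1}. cell n x = k} =
      emeasure lborel {x \<in> {0..1}. cell n x = k}"
    by (intro emeasure_restrict_space) auto
  also have "\<dots> = ennreal (1 / real n)"
    using assms by (subst cell_preimage) (auto simp: field_simps of_nat_diff)
  finally show ?thesis .
qed

text \<open>The coupling is the image of Lebesgue measure under the graph of the step function that
  sends the \<open>k\<close>-th interval of length \<open>1 / n\<close> to the \<open>k\<close>-th point, and the correspondence
  is that graph.\<close>
lemma d_GHP_unit_interval_bounds:
  fixes f :: "nat \<Rightarrow> 'a" and d :: "'a \<Rightarrow> 'a \<Rightarrow> real"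
  assumes n: "0 < n" and f: "bij_betw f {1..n} E"
    and D: "\<And>r r'. r \<in> {1..n} \<Longrightarrow> r' \<in> {1..n} \<Longrightarrow>
              \<bar>d (f r) (f r') - \<bar>real r - real r'\<bar> / real n\<bar> \<le> D"
  shows "0 \<le> d_GHP E d (uniform_count_measure E) {0..1::real} (\<lambda>x y. \<bar>x - y\<bar>) (restrict_space lborel {0..1})"
    and "d_GHP E d (uniform_count_measure E) {0..1::real} (\<lambda>x y. \<bar>x - y\<bar>) (restrict_space lborel {0..1})
           \<le> D + 2 / real n"
proof -
  let ?U = "uniform_count_measure E" and ?L = "restrict_space lborel {0..1::real}"
  define g where "g x = (f (cell n x), x)" for x
  define C where "C = g ` {0..1}"
  define M where "M = distr ?L (?U \<Otimes>\<^sub>M ?L) g"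
  interpret L: prob_space ?L by (rule prob_space_unit_interval)
  have fin: "finite E" and card: "card E = n"
    using f bij_betw_finite[OF f] bij_betw_same_card[OF f] by auto
  have fE: "f r \<in> E" if "r \<in> {1..n}" for r
    using f that by (auto simp: bij_betw_def)
  have [measurable]: "(\<lambda>x. f (cell n x)) \<in> ?L \<rightarrow>\<^sub>M ?U"
  proof -
    have "cell n \<in> ?L \<rightarrow>\<^sub>M count_space UNIV"
      by (intro measurable_restrict_space1) simp
    then have 1: "(\<lambda>x. f (cell n x)) \<in> ?L \<rightarrow>\<^sub>M count_space UNIV"
      by (rule measurable_compose) simp
    have "(\<lambda>x. f (cell n x)) \<in> ?L \<rightarrow>\<^sub>M count_space E"
      using measurable_restrict_space2[OF _ 1, of E] fE cell_range[OF n]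
      by (auto simp: space_restrict_space restrict_count_space)
    then show ?thesis
      by (simp add: measurable_cong_sets[OF refl sets_uniform_count_measure_count_space])
  qed
  have g [measurable]: "g \<in> ?L \<rightarrow>\<^sub>M ?U \<Otimes>\<^sub>M ?L"
    unfolding g_def by measurable
  have corr: "is_correspondence E {0..1} C"
    unfolding is_correspondence_def
  proof (intro conjI)
    show "C \<subseteq> E \<times> {0..1}"
      using fE cell_range[OF n] by (auto simp: C_def g_def)
    show "snd ` C = {0..1}"
      by (auto simp: C_def g_def image_image)
    show "fst ` C = E"
    proof
      show "fst ` C \<subseteq> E" using \<open>C \<subseteq> E \<times> {0..1}\<close> by auto
      show "E \<subseteq> fst ` C"
      proof
        fix e assume "e \<in> E"
        then obtain k where k: "k \<in> {1..n}" "e = f k"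
          using f by (auto simp: bij_betw_def)
        then have "e = fst (g (real k / real n))"
          using cell_of_fraction[OF n] by (simp add: g_def)
        moreover have "real k / real n \<in> {0..1}" using k n by auto
        ultimately show "e \<in> fst ` C" by (auto simp: C_def)
      qed
    qed
  qed
  \<comment> \<open>The graph of a step function is a finite union of measurable rectangles.\<close>
  have Cset: "C \<in> sets (?U \<Otimes>\<^sub>M ?L)"
  proof -
    have "C = (\<Union>k\<in>{1..n}. {f k} \<times> {x \<in> {0..1}. cell n x = k})"
      using cell_range[OF n] by (auto simp: C_def g_def)
    moreover have "{f k} \<times> {x \<in> {0..1}. cell n x = k} \<in> sets (?U \<Otimes>\<^sub>M ?L)" if "k \<in> {1..n}" for k
    proof (rule pair_measureI)
      show "{f k} \<in> sets ?U" using fE[OF that] by (simp add: sets_uniform_count_measure)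
      show "{x \<in> {0..1}. cell n x = k} \<in> sets ?L"
        by (subst sets_restrict_space_iff) auto
    qed
    ultimately show ?thesis by auto
  qed
  have "distr M ?U fst = distr ?L ?U (\<lambda>x. f (cell n x))"
    unfolding M_def by (subst distr_distr) (auto simp: comp_def g_def)
  also have "\<dots> = ?U"
  proof (rule measure_eqI_finite[where A = E])
    fix e assume "e \<in> E"
    then obtain k where k: "k \<in> {1..n}" "e = f k"
      using f by (auto simp: bij_betw_def)
    have "(\<lambda>x. f (cell n x)) -` {e} \<inter> space ?L = {x \<in> {0..1}. cell n x = k}"
      using k cell_range[OF n] f by (auto simp: space_restrict_space bij_betw_def dest: inj_onD)
    then show "emeasure (distr ?L ?U (\<lambda>x. f (cell n x))) {e} = emeasure ?U {e}"
      using \<open>e \<in> E\<close> emeasure_cell[OF n k(1)]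
      by (subst emeasure_distr) (auto simp: sets_uniform_count_measure emeasure_uniform_count_measure fin card)
  qed (auto simp: sets_uniform_count_measure fin)
  finally have m1: "distr M ?U fst = ?U" .
  have "distr M ?L snd = distr ?L ?L (\<lambda>x. x)"
    unfolding M_def by (subst distr_distr) (auto simp: comp_def g_def)
  then have coupl: "is_coupling ?U ?L M"
    using m1 by (auto simp: is_coupling_def M_def L.prob_space_distr)
  \<comment> \<open>\<open>M\<close> is carried by the graph, so the mass condition holds for every
    positive \<open>\<epsilon>\<close> and only the distortion matters.\<close>
  have MC: "measure M C = 1"
  proof -
    have "g -` C \<inter> space ?L = space ?L" by (auto simp: C_def space_restrict_space)
    then show ?thesis
      unfolding M_def using Cset L.prob_space by (simp only: measure_distr[OF g])
  qed
  have "0 \<le> D" using D[of 1 1] n by force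
  \<comment> \<open>Rounding the two arguments to the grid costs \<open>1 / real n\<close> each. The
    same summand keeps \<open>e\<close> positive when \<open>D = 0\<close>.\<close>
  define e where "e = D + 2 / real n"
  have e: "e > 0" using \<open>0 \<le> D\<close> n by (simp add: e_def add_nonneg_pos)
  have dis: "distortion_le d (\<lambda>x y. \<bar>x - y\<bar>) C (2 * e)"
  proof -
    have "\<bar>d (fst (g x)) (fst (g y)) - \<bar>snd (g x) - snd (g y)\<bar>\<bar> \<le> 2 * e"
      if xy: "x \<in> {0..1}" "y \<in> {0..1}" for x y
    proof -
      let ?r = "real (cell n x) / real n" and ?s = "real (cell n y) / real n"
      have "\<bar>real (cell n x) - real (cell n y)\<bar> / real n = \<bar>?r - ?s\<bar>"
        using n by (simp add: diff_divide_distrib[symmetric])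
      then have "\<bar>d (f (cell n x)) (f (cell n y)) - \<bar>?r - ?s\<bar>\<bar> \<le> D"
        using D[OF cell_range[OF n xy(1)] cell_range[OF n xy(2)]] by simp
      moreover have "\<bar>x - ?r\<bar> \<le> 1 / real n" "\<bar>y - ?s\<bar> \<le> 1 / real n"
        using cell_approx[OF n] xy by auto
      ultimately have "\<bar>d (f (cell n x)) (f (cell n y)) - \<bar>x - y\<bar>\<bar> \<le> D + 2 * (1 / real n)"
        by linarith
      then show ?thesis
        using e by (simp add: g_def e_def)
    qed
    then show ?thesis
      by (auto simp: distortion_le_def C_def)
  qed
  let ?S = "{\<epsilon>. \<epsilon> > 0 \<and> (\<exists>C M. is_correspondence E {0..1::real} C \<and> is_coupling ?U ?L M
       \<and> C \<in> sets M \<and> measure M C \<ge> 1 - \<epsilon> \<and> distortion_le d (\<lambda>x y. \<bar>x - y\<bar>) C (2 * \<epsilon>))}"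
  have eS: "e \<in> ?S"
    using e corr coupl Cset MC dis by (auto simp: M_def intro!: exI[of _ C] exI[of _ M])
  have "bdd_below ?S" by (rule bdd_belowI[of _ 0]) auto
  then show "d_GHP E d ?U {0..1::real} (\<lambda>x y. \<bar>x - y\<bar>) ?L \<le> D + 2 / real n"
    unfolding d_GHP_def e_def[symmetric] using eS by (intro cInf_lower)
  show "0 \<le> d_GHP E d ?U {0..1::real} (\<lambda>x y. \<bar>x - y\<bar>) ?L"
    unfolding d_GHP_def using eS by (intro cInf_greatest) auto
qed

section \<open>From record counts to the GHP distance\<close>

text \<open>The bound on record counts acts twice. It places the rank \<open>r\<close> on the spine
  at height about \<open>p * real r\<close>, and it forces keys with equal record counts into a
  short range of ranks, which keeps the hanging subtrees shallow.\<close>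

lemma d_GHP_bst_bounds:
  fixes p \<delta> :: real
  assumes n: "0 < n" and L: "distinct L" "set L = {1..n}" and p: "0 < p"
    and K: "\<And>r. r \<in> {1..n} \<Longrightarrow> \<bar>real (records_below L r) - p * real r\<bar> \<le> \<delta> * real n"
  defines "G \<equiv> d_GHP (bst L) (\<lambda>u v. real (graph_dist (bst L) u v) / (p * real n))
        (uniform_count_measure (bst L)) {0..1::real} (\<lambda>x y. \<bar>x - y\<bar>) (restrict_space lborel {0..1::real})"
  shows "0 \<le> G" and "G \<le> \<delta> * (4 / p\<^sup>2 + 2 / p) + (2 / p + 2) / real n"
proof -
  let ?K = "\<lambda>r. real (records_below L r)"
  \<comment> \<open>Each of the two subtree depths contributes
    \<open>2 * \<delta> * real n / p + 1\<close> and the two spine heights together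
    \<open>2 * \<delta> * real n\<close>; \<open>D\<close> is the sum divided by
    \<open>p * real n\<close>.\<close>
  define D where "D = \<delta> * (4 / p\<^sup>2 + 2 / p) + 2 / p / real n"
  have bs: "real (card {u \<in> set L. records_below L u = records_below L v}) \<le> 2 * \<delta> * real n / p + 1"
    if v: "v \<in> {1..n}" for v
  proof -
    let ?A = "{u \<in> set L. records_below L u = records_below L v}"
    have A: "finite ?A" "v \<in> ?A" using v L by auto
    have close: "real u - real u' \<le> 2 * \<delta> * real n / p" if u: "u \<in> ?A" "u' \<in> ?A" for u u'
    proof -
      have "p * (real u - real u') \<le> 2 * \<delta> * real n"
        using K[of u] K[of u'] u L by (auto simp: algebra_simps)
      then show ?thesis using p by (simp add: field_simps)
    qed
    have mm: "Min ?A \<in> ?A" "Max ?A \<in> ?A"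
      using A Min_in[of ?A] Max_in[of ?A] by blast+
    moreover have "Min ?A \<le> Max ?A"
      using A by (meson Min_le Max_ge order.trans)
    \<comment> \<open>The class fits into the integer interval spanned by its extreme ranks;
      counting both endpoints gives the \<open>+ 1\<close>.\<close>
    moreover have "card ?A \<le> card {Min ?A..Max ?A}"
      using A by (intro card_mono) auto
    ultimately show ?thesis
      using close[OF mm(2) mm(1)] by (simp only: card_atLeastAtMost)
  qed
  have main: "\<bar>real (graph_dist (bst L) (node L r) (node L r')) / (p * real n)
          - \<bar>real r - real r'\<bar> / real n\<bar> \<le> D"
    if r: "r \<in> {1..n}" "r' \<in> {1..n}" for r r'
  proof -
    let ?d = "real (graph_dist (bst L) (node L r) (node L r'))"
    obtain w where w: "node L r = replicate (records_below L r) True @ w"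
        "length w \<le> card {u \<in> set L. records_below L u = records_below L r}"
      using node_decomp[of r L] r L by auto
    obtain w' where w': "node L r' = replicate (records_below L r') True @ w'"
        "length w' \<le> card {u \<in> set L. records_below L u = records_below L r'}"
      using node_decomp[of r' L] r L by auto
    have mem: "node L r \<in> bst L" "node L r' \<in> bst L"
      using r L by (auto simp: bst_eq_node_image)
    have "\<bar>?d - \<bar>?K r - ?K r'\<bar>\<bar> \<le> real (length w) + real (length w')"
      using graph_dist_spine[of "bst L" "records_below L r" w "records_below L r'" w', OF bst_prefix]
        mem w(1) w'(1) by simp
    also have "\<dots> \<le> (2 * \<delta> * real n / p + 1) + (2 * \<delta> * real n / p + 1)"
      using w(2) w'(2) bs[OF r(1)] bs[OF r(2)] by (intro add_mono) linarith+
    finally have 1: "\<bar>?d - \<bar>?K r - ?K r'\<bar>\<bar> \<le> (2 * \<delta> * real n / p + 1) + (2 * \<delta> * real n / p + 1)" .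
    have "\<bar>\<bar>?K r - ?K r'\<bar> - \<bar>p * real r - p * real r'\<bar>\<bar> \<le> 2 * \<delta> * real n"
      using K[OF r(1)] K[OF r(2)] by linarith
    moreover have "\<bar>p * real r - p * real r'\<bar> = p * \<bar>real r - real r'\<bar>"
      using p by (simp add: abs_mult right_diff_distrib[symmetric])
    ultimately have 2: "\<bar>\<bar>?K r - ?K r'\<bar> - p * \<bar>real r - real r'\<bar>\<bar> \<le> 2 * \<delta> * real n"
      by (simp only:)
    have "\<bar>?d - p * \<bar>real r - real r'\<bar>\<bar> \<le>
        \<bar>?d - \<bar>?K r - ?K r'\<bar>\<bar> + \<bar>\<bar>?K r - ?K r'\<bar> - p * \<bar>real r - real r'\<bar>\<bar>"
      by (rule order.trans[OF _ abs_triangle_ineq]) simp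
    also have "\<dots> \<le> (2 * \<delta> * real n / p + 1) + (2 * \<delta> * real n / p + 1) + 2 * \<delta> * real n"
      by (rule add_mono[OF 1 2])
    also have "\<dots> = 4 * \<delta> * real n / p + 2 + 2 * \<delta> * real n"
      by simp
    finally have "\<bar>?d - p * \<bar>real r - real r'\<bar>\<bar> \<le> 4 * \<delta> * real n / p + 2 + 2 * \<delta> * real n" .
    then have "\<bar>?d - p * \<bar>real r - real r'\<bar>\<bar> / (p * real n)
        \<le> (4 * \<delta> * real n / p + 2 + 2 * \<delta> * real n) / (p * real n)"
      using p n by (intro divide_right_mono) auto
    moreover have "(4 * \<delta> * real n / p + 2 + 2 * \<delta> * real n) / (p * real n) = D"
      using p n by (simp add: D_def field_simps power2_eq_square)
    moreover have "\<bar>?d - p * \<bar>real r - real r'\<bar>\<bar> / (p * real n) =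
        \<bar>(?d - p * \<bar>real r - real r'\<bar>) / (p * real n)\<bar>"
      using p n by (simp add: abs_divide)
    moreover have "(?d - p * \<bar>real r - real r'\<bar>) / (p * real n) = ?d / (p * real n) - \<bar>real r - real r'\<bar> / real n"
      using p n by (simp add: diff_divide_distrib)
    ultimately show ?thesis by simp
  qed
  have bij: "bij_betw (node L) {1..n} (bst L)"
    using inj_on_node[of L] L by (simp add: bij_betw_def bst_eq_node_image)
  show "0 \<le> G"
    unfolding G_def by (rule d_GHP_unit_interval_bounds(1)[OF n bij main])
  have "G \<le> D + 2 / real n"
    unfolding G_def by (rule d_GHP_unit_interval_bounds(2)[OF n bij main])
  then show "G \<le> \<delta> * (4 / p\<^sup>2 + 2 / p) + (2 / p + 2) / real n"
    by (simp add: D_def add_divide_distrib)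
qed

section \<open>Records of the sequence of chosen columns\<close>

text \<open>Ensures that every row has a one in a free column, so that the \<open>LEAST\<close>
  defining \<open>I\<close> is a genuine minimum.\<close>

definition rows_unbounded :: "(nat \<times> nat \<Rightarrow> bool) \<Rightarrow> bool" where
  "rows_unbounded B \<longleftrightarrow> (\<forall>i N. \<exists>j>N. B (i, j))"

lemma length_Iseq [simp]: "length (Iseq B n) = n"
  by (induction n) auto

lemma Iseq_nth: "i < n \<Longrightarrow> Iseq B n ! i = Ival B (Suc i)"
proof (induction n)
  case (Suc n)
  then show ?case
    by (cases "i = n") (auto simp: Ival_def nth_append simp del: Iseq.simps(2), simp add: nth_append)
qed simp

lemma set_Iseq: "set (Iseq B n) = Ival B ` {1..n}"
proof -
  have "set (Iseq B n) = (\<lambda>i. Ival B (Suc i)) ` {..<n}"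
    by (auto simp: set_conv_nth Iseq_nth image_iff) (metis Iseq_nth)
  also have "\<dots> = Ival B ` (Suc ` {..<n})"
    by (simp add: image_image)
  also have "Suc ` {..<n} = {1..n}"
    by (rule image_Suc_lessThan)
  finally show ?thesis .
qed

lemma Ival_Suc:
  "Ival B (Suc n) = (LEAST j. 1 \<le> j \<and> j \<notin> Ival B ` {1..n} \<and> B (Suc n, j))"
  by (simp add: Ival_def nth_append set_Iseq)

lemma Ival_Suc_le:
  "1 \<le> j \<Longrightarrow> j \<notin> Ival B ` {1..n} \<Longrightarrow> B (Suc n, j) \<Longrightarrow> Ival B (Suc n) \<le> j"
  unfolding Ival_Suc by (rule Least_le) auto

lemma Ival_Suc_props:
  assumes "rows_unbounded B"
  shows "1 \<le> Ival B (Suc n)" "Ival B (Suc n) \<notin> Ival B ` {1..n}" "B (Suc n, Ival B (Suc n))"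
proof -
  \<comment> \<open>A column beyond the sum of all earlier values differs from each of them, hence
    is free.\<close>
  obtain j where j: "j > (\<Sum>i\<in>{1..n}. Ival B i)" "B (Suc n, j)"
    using assms by (auto simp: rows_unbounded_def)
  have "Ival B i < j" if "i \<in> {1..n}" for i
    using member_le_sum[of i "{1..n}" "Ival B"] that j(1) by simp
  then have "1 \<le> j \<and> j \<notin> Ival B ` {1..n} \<and> B (Suc n, j)"
    using j by force
  then have "1 \<le> Ival B (Suc n) \<and> Ival B (Suc n) \<notin> Ival B ` {1..n} \<and> B (Suc n, Ival B (Suc n))"
    unfolding Ival_Suc by (rule LeastI)
  then show "1 \<le> Ival B (Suc n)" "Ival B (Suc n) \<notin> Ival B ` {1..n}" "B (Suc n, Ival B (Suc n))"
    by auto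
qed

lemma Ival_props:
  assumes "rows_unbounded B" "1 \<le> i"
  shows "1 \<le> Ival B i" "B (i, Ival B i)"
  using Ival_Suc_props[OF assms(1), of "i - 1"] assms(2) by auto

lemma inj_on_Ival:
  assumes "rows_unbounded B"
  shows "inj_on (Ival B) {1..}"
proof (rule linorder_inj_onI)
  fix i j :: nat
  assume "i < j" "i \<in> {1..}" "j \<in> {1..}"
  then obtain n where "j = Suc n" "i \<in> {1..n}"
    by (cases j) auto
  then show "Ival B i \<noteq> Ival B j"
    using Ival_Suc_props(2)[OF assms, of n] by (metis imageI)
qed auto

section \<open>Locality of the chosen columns\<close>

lemma Ival_determined_step:
  assumes B: "rows_unbounded B" and agree: "\<And>i j. j < m \<Longrightarrow> B (i, j) \<longleftrightarrow> C (i, j)"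
    and used: "\<And>v. v < m \<Longrightarrow> v \<in> Ival B ` {1..n} \<longleftrightarrow> v \<in> Ival C ` {1..n}"
    and v: "Ival B (Suc n) = v" "v < m"
  shows "Ival C (Suc n) = v"
  unfolding Ival_Suc[of C]
proof (rule Least_equality)
  show "1 \<le> v \<and> v \<notin> Ival C ` {1..n} \<and> C (Suc n, v)"
    using Ival_Suc_props[OF B, of n] v agree used by auto
  fix y assume y: "1 \<le> y \<and> y \<notin> Ival C ` {1..n} \<and> C (Suc n, y)"
  show "v \<le> y"
  proof (rule ccontr)
    assume "\<not> v \<le> y"
    then have "y < m" "y < v" using v by auto
    with y agree used have "Ival B (Suc n) \<le> y"
      by (intro Ival_Suc_le) auto
    with \<open>y < v\<close> v show False by simp
  qed
qed

text \<open>Induction over the rows: values from \<open>m\<close> on may differ between the two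
  arrays, but the set of occupied columns before \<open>m\<close> stays the same, and it decides
  with the entries there whether the next minimum is a given \<open>v < m\<close>.\<close>

lemma Ival_determined:
  assumes BC: "rows_unbounded B" "rows_unbounded C"
    and agree: "\<And>i j. j < m \<Longrightarrow> B (i, j) \<longleftrightarrow> C (i, j)"
    and "1 \<le> i" "v < m"
  shows "Ival B i = v \<longleftrightarrow> Ival C i = v"
  using assms(4,5)
proof (induction i arbitrary: v rule: less_induct)
  case (less i)
  obtain n where n: "i = Suc n" using less.prems by (cases i) auto
  have used: "v \<in> Ival B ` {1..n} \<longleftrightarrow> v \<in> Ival C ` {1..n}" if "v < m" for v
  proof -
    have "v = Ival B k \<longleftrightarrow> v = Ival C k" if "k \<in> {1..n}" for k
      using less.IH[of k v] n that \<open>v < m\<close> by (metis atLeastAtMost_iff le_imp_less_Suc)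
    then show ?thesis unfolding image_iff by (rule bex_cong[OF refl])
  qed
  have "Ival C (Suc n) = v" if "Ival B (Suc n) = v"
  proof (rule Ival_determined_step[where B = B and m = m])
    show "rows_unbounded B" "Ival B (Suc n) = v" "v < m"
      using BC that less.prems by auto
  qed (use agree used in simp_all)
  moreover have "Ival B (Suc n) = v" if "Ival C (Suc n) = v"
  proof (rule Ival_determined_step[where B = C and m = m])
    show "rows_unbounded C" "Ival C (Suc n) = v" "v < m"
      using BC that less.prems by auto
  qed (use agree used in simp_all)
  ultimately show ?case
    using n by blast
qed

text \<open>Column \<open>m\<close> is first examined by the first row \<open>i\<close> with \<open>I\<^sub>i \<ge> m\<close>. Declaring all entries
  from column \<open>m\<close> on to be true does not change this row, and makes it depend on the columns
  before \<open>m\<close> only, without any assumption on \<open>B\<close>.\<close>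
definition truncate_cols :: "nat \<Rightarrow> (nat \<times> nat \<Rightarrow> bool) \<Rightarrow> nat \<times> nat \<Rightarrow> bool" where
  "truncate_cols m B = (\<lambda>(i, j). m \<le> j \<or> B (i, j))"

definition first_reach :: "(nat \<times> nat \<Rightarrow> bool) \<Rightarrow> nat \<Rightarrow> nat" where
  "first_reach B m = (LEAST i. 1 \<le> i \<and> m \<le> Ival (truncate_cols m B) i)"

definition record_col :: "(nat \<times> nat \<Rightarrow> bool) \<Rightarrow> nat \<Rightarrow> bool" where
  "record_col B m \<longleftrightarrow> B (first_reach B m, m)"

lemma rows_unbounded_truncate: "rows_unbounded (truncate_cols m B)"
  unfolding rows_unbounded_def
proof (intro allI)
  fix i N show "\<exists>j>N. truncate_cols m B (i, j)"
    by (rule exI[of _ "Suc (m + N)"]) (simp add: truncate_cols_def)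
qed

text \<open>Pigeonhole: \<open>m\<close> distinct positive values cannot all be smaller than
  \<open>m\<close>.\<close>

lemma ex_Ival_ge:
  assumes "rows_unbounded B" "1 \<le> m"
  shows "\<exists>i\<in>{1..m}. m \<le> Ival B i"
proof (rule ccontr)
  assume "\<not> ?thesis"
  then have "Ival B ` {1..m} \<subseteq> {1..<m}"
    using Ival_props(1)[OF assms(1)] by force
  then have "card (Ival B ` {1..m}) \<le> m - 1"
    using card_mono[of "{1..<m}"] by simp
  moreover have "card (Ival B ` {1..m}) = m"
    using inj_on_subset[OF inj_on_Ival[OF assms(1)], of "{1..m}"] by (simp add: card_image)
  ultimately show False using assms(2) by simp
qed

text \<open>The finite range allows expectations to be split over the value of
  \<open>first_reach\<close>.\<close>

lemma first_reach_range:
  assumes "1 \<le> m"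
  shows "first_reach B m \<in> {1..m}"
proof -
  obtain i where i: "i \<in> {1..m}" "m \<le> Ival (truncate_cols m B) i"
    using ex_Ival_ge[OF rows_unbounded_truncate assms] by blast
  then have "first_reach B m \<le> i"
    unfolding first_reach_def by (intro Least_le) auto
  moreover have "1 \<le> first_reach B m \<and> m \<le> Ival (truncate_cols m B) (first_reach B m)"
    unfolding first_reach_def by (rule LeastI[of _ i]) (use i in auto)
  ultimately show ?thesis using i by auto
qed

text \<open>By locality, truncation leaves all values below \<open>m\<close> in place, hence also
  the rows whose value is at least \<open>m\<close>.\<close>

lemma first_reach_eq:
  assumes "rows_unbounded B"
  shows "first_reach B m = (LEAST i. 1 \<le> i \<and> m \<le> Ival B i)"
proof -
  have "m \<le> Ival (truncate_cols m B) i \<longleftrightarrow> m \<le> Ival B i" if "1 \<le> i" for i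
  proof -
    have "Ival (truncate_cols m B) i = v \<longleftrightarrow> Ival B i = v" if "v < m" for v
      by (rule Ival_determined[of "truncate_cols m B" B m i v, OF rows_unbounded_truncate assms _ \<open>1 \<le> i\<close> that])
        (auto simp: truncate_cols_def)
    then show ?thesis by (metis not_le)
  qed
  then show ?thesis
    unfolding first_reach_def by (intro arg_cong[where f = Least] ext) auto
qed

text \<open>When row \<open>first_reach B m\<close> is processed, column \<open>m\<close> is still
  free, since all earlier values are smaller; a one there forces the value to be exactly
  \<open>m\<close>. Conversely, the row of a record \<open>m\<close> is the first to reach
  \<open>m\<close>, and it selects a one.\<close>

lemma record_col_iff:
  assumes B: "rows_unbounded B" and m: "1 \<le> m"
  shows "record_col B m \<longleftrightarrow> (\<exists>t\<ge>1. Ival B t = m \<and> (\<forall>s\<in>{1..<t}. Ival B s < m))"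
proof
  let ?t = "first_reach B m"
  have t: "1 \<le> ?t \<and> m \<le> Ival B ?t"
    unfolding first_reach_eq[OF B]
    by (rule LeastI_ex[of "\<lambda>i. 1 \<le> i \<and> m \<le> Ival B i"]) (use ex_Ival_ge[OF B m] in auto)
  have before: "Ival B s < m" if "s \<in> {1..<?t}" for s
    using not_less_Least[of s "\<lambda>i. 1 \<le> i \<and> m \<le> Ival B i"] that
    unfolding first_reach_eq[OF B] by auto
  assume "record_col B m"
  then have "B (?t, m)" by (simp add: record_col_def)
  moreover obtain n where n: "?t = Suc n" using t by (cases ?t) auto
  moreover have "m \<notin> Ival B ` {1..n}"
    using before n by force
  ultimately have "Ival B ?t \<le> m"
    using Ival_Suc_le[of m B n] m by auto
  with t before show "\<exists>t\<ge>1. Ival B t = m \<and> (\<forall>s\<in>{1..<t}. Ival B s < m)"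
    by (intro exI[of _ ?t]) auto
next
  assume "\<exists>t\<ge>1. Ival B t = m \<and> (\<forall>s\<in>{1..<t}. Ival B s < m)"
  then obtain t where t: "1 \<le> t" "Ival B t = m" "\<And>s. s \<in> {1..<t} \<Longrightarrow> Ival B s < m"
    by auto
  have "first_reach B m = t"
    unfolding first_reach_eq[OF B]
    by (rule Least_equality) (use t in \<open>auto simp: not_less[symmetric]\<close>)
  then show "record_col B m"
    using Ival_props(2)[OF B t(1)] t(2) by (simp add: record_col_def)
qed

section \<open>Ranks versus values\<close>

lemma Perm_n_less_iff:
  assumes "i \<in> {1..n}" "j \<in> {1..n}"
  shows "Perm_n B n i < Perm_n B n j \<longleftrightarrow> Ival B i < Ival B j"
proof -
  have mono: "Perm_n B n i \<le> Perm_n B n j" if "Ival B i \<le> Ival B j" for i j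
    unfolding Perm_n_def using that by (intro card_mono) auto
  have "Perm_n B n i < Perm_n B n j" if "Ival B i < Ival B j"
    unfolding Perm_n_def
  proof (rule psubset_card_mono)
    have "j \<in> {k \<in> {1..n}. Ival B k \<le> Ival B j}" "j \<notin> {k \<in> {1..n}. Ival B k \<le> Ival B i}"
      using that assms by auto
    moreover have "{k \<in> {1..n}. Ival B k \<le> Ival B i} \<subseteq> {k \<in> {1..n}. Ival B k \<le> Ival B j}"
      using that by auto
    ultimately show "{k \<in> {1..n}. Ival B k \<le> Ival B i} \<subset> {k \<in> {1..n}. Ival B k \<le> Ival B j}"
      by blast
  qed simp
  with mono[of j i] show ?thesis
    by (metis leD not_le)
qed

lemma inj_on_Perm_n:
  assumes "rows_unbounded B"
  shows "inj_on (Perm_n B n) {1..n}"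
proof (rule inj_onI)
  fix i j assume ij: "i \<in> {1..n}" "j \<in> {1..n}" "Perm_n B n i = Perm_n B n j"
  then have "Ival B i = Ival B j"
    using Perm_n_less_iff[of i n j B] Perm_n_less_iff[of j n i B] by auto
  then show "i = j"
    using inj_onD[OF inj_on_Ival[OF assms]] ij by auto
qed

lemma Perm_n_image:
  assumes "rows_unbounded B"
  shows "Perm_n B n ` {1..n} = {1..n}"
proof (rule card_subset_eq)
  have "Perm_n B n i \<in> {1..n}" if "i \<in> {1..n}" for i
  proof -
    let ?A = "{j \<in> {1..n}. Ival B j \<le> Ival B i}"
    have "card ?A \<le> card {1..n}" by (intro card_mono) auto
    moreover have "0 < card ?A" using that by (subst card_gt_0_iff) auto
    ultimately show ?thesis unfolding Perm_n_def by (simp only: card_atLeastAtMost atLeastAtMost_iff) simp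
  qed
  then show "Perm_n B n ` {1..n} \<subseteq> {1..n}" by auto
  show "card (Perm_n B n ` {1..n}) = card {1..n}"
    using inj_on_Perm_n[OF assms] by (rule card_image)
qed auto

lemma is_record_map_upt:
  fixes f :: "nat \<Rightarrow> nat"
  assumes f: "inj_on f {1..n}" and t: "t \<in> {1..n}"
  shows "is_record (map f [1..<Suc n]) (f t) \<longleftrightarrow> (\<forall>s\<in>{1..<t}. f s < f t)"
proof -
  have "[1..<Suc n] = [1..<t] @ t # [Suc t..<Suc n]"
    using upt_add_eq_append[of 1 t "Suc n - t"] upt_conv_Cons[of t "Suc n"] t by (simp del: upt_Suc)
  moreover have "f s \<noteq> f t" if "s \<in> set [1..<t]" for s
    using inj_onD[OF f, of s t] that t by auto
  ultimately have "takeWhile (\<lambda>z. z \<noteq> f t) (map f [1..<Suc n]) = map f [1..<t]"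
    by (simp del: upt_Suc add: takeWhile_append)
  then show ?thesis
    using t unfolding is_record_def by (auto simp del: upt_Suc)
qed

text \<open>The tree sees only the first \<open>n\<close> rows while \<open>record_col\<close>
  refers to all of them. The counts agree because records below \<open>I\<close> of row
  \<open>i\<close> must occur before row \<open>i\<close>.\<close>

lemma records_below_Perm_n:
  assumes B: "rows_unbounded B" and i: "i \<in> {1..n}"
  shows "records_below (map (Perm_n B n) [1..<Suc n]) (Perm_n B n i) =
           card {m \<in> {1..<Ival B i}. record_col B m}"
proof -
  let ?f = "Perm_n B n"
  define T where "T = {t \<in> {1..n}. (\<forall>s\<in>{1..<t}. Ival B s < Ival B t) \<and> Ival B t < Ival B i}"
  have rec: "is_record (map ?f [1..<Suc n]) (?f t) \<longleftrightarrow> (\<forall>s\<in>{1..<t}. Ival B s < Ival B t)"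
    if "t \<in> {1..n}" for t
    unfolding is_record_map_upt[OF inj_on_Perm_n[OF B] that]
    using that by (intro ball_cong refl Perm_n_less_iff) auto
  have "{l. is_record (map ?f [1..<Suc n]) l \<and> l < ?f i} = ?f ` T"
  proof (intro set_eqI iffI)
    fix l assume l: "l \<in> {l. is_record (map ?f [1..<Suc n]) l \<and> l < ?f i}"
    then obtain t where t: "t \<in> {1..n}" "l = ?f t"
      by (auto simp: is_record_def less_Suc_eq_le simp del: upt_Suc)
    then show "l \<in> ?f ` T"
      using l rec[of t] Perm_n_less_iff[of t n i B] i by (auto simp: T_def)
  next
    fix l assume "l \<in> ?f ` T"
    then obtain t where "t \<in> T" "l = ?f t" by auto
    then show "l \<in> {l. is_record (map ?f [1..<Suc n]) l \<and> l < ?f i}"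
      using rec[of t] Perm_n_less_iff[of t n i B] i by (auto simp: T_def simp del: upt_Suc)
  qed
  moreover have "inj_on ?f T"
    by (rule inj_on_subset[OF inj_on_Perm_n[OF B]]) (auto simp: T_def)
  ultimately have 1: "records_below (map ?f [1..<Suc n]) (?f i) = card T"
    by (simp only: records_below_def card_image)
  have "{m \<in> {1..<Ival B i}. record_col B m} = Ival B ` T"
  proof (intro set_eqI iffI)
    fix m assume m: "m \<in> {m \<in> {1..<Ival B i}. record_col B m}"
    then obtain t where t: "1 \<le> t" "Ival B t = m" "\<forall>s\<in>{1..<t}. Ival B s < m"
      using record_col_iff[OF B, of m] by auto
    \<comment> \<open>A record set after row \<open>n\<close> comes after row \<open>i\<close> and
      would exceed its value.\<close>
    have "t \<le> n"
    proof (rule ccontr)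
      assume "\<not> t \<le> n"
      then have "i \<in> {1..<t}" using i by auto
      with t(3) m show False by force
    qed
    with t m show "m \<in> Ival B ` T" by (auto simp: T_def)
  next
    fix m assume "m \<in> Ival B ` T"
    then obtain t where t: "t \<in> T" "m = Ival B t" by auto
    then have "1 \<le> m" using Ival_props(1)[OF B] by (auto simp: T_def)
    with t show "m \<in> {m \<in> {1..<Ival B i}. record_col B m}"
      using record_col_iff[OF B, of m] by (auto simp: T_def)
  qed
  moreover have "inj_on (Ival B) T"
    by (rule inj_on_subset[OF inj_on_Ival[OF B]]) (auto simp: T_def)
  ultimately have "card {m \<in> {1..<Ival B i}. record_col B m} = card T"
    by (simp only: card_image)
  with 1 show ?thesis by simp
qed

text \<open>The rank counts the occupied columns up to the value. Among the first \<open>b\<close>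
  columns exactly \<open>n\<close> are occupied, so at most \<open>b - n\<close> gaps separate rank
  and value.\<close>

lemma Perm_n_bounds:
  assumes B: "rows_unbounded B" and i: "i \<in> {1..n}"
    and b: "\<And>j. j \<in> {1..n} \<Longrightarrow> Ival B j \<le> b"
  shows "Perm_n B n i \<le> Ival B i" and "Ival B i + n \<le> Perm_n B n i + b"
proof -
  let ?v = "Ival B i" and ?I = "Ival B ` {1..n}"
  have inj: "inj_on (Ival B) {1..n}"
    using inj_on_subset[OF inj_on_Ival[OF B]] by auto
  have sub: "?I \<subseteq> {1..b}"
    using Ival_props(1)[OF B] b by force
  have "Perm_n B n i = card (Ival B ` {j \<in> {1..n}. Ival B j \<le> ?v})"
    unfolding Perm_n_def by (intro card_image[symmetric] inj_on_subset[OF inj]) auto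
  also have "Ival B ` {j \<in> {1..n}. Ival B j \<le> ?v} = {1..?v} \<inter> ?I"
    using sub by force
  finally have P: "Perm_n B n i = card ({1..?v} \<inter> ?I)" .
  have split: "card ({1..?v} \<inter> ?I) + card ({1..?v} - ?I) = ?v"
    using card_Int_Diff[of "{1..?v}" ?I] by simp
  with P show "Perm_n B n i \<le> ?v" by simp
  have "card ({1..?v} - ?I) \<le> card ({1..b} - ?I)"
    using b[OF i] by (intro card_mono) auto
  also have "\<dots> = b - n"
    using sub inj by (simp add: card_Diff_subset card_image)
  finally have "card ({1..?v} - ?I) \<le> b - n" .
  moreover have "n \<le> b"
    using card_mono[OF _ sub] inj by (simp add: card_image)
  ultimately show "?v + n \<le> Perm_n B n i + b"
    using P split by linarith
qed

section \<open>Deterministic limit for a fixed array\<close>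

text \<open>For the rank \<open>r\<close> of row \<open>i\<close> the count is that of the record
  columns before \<open>Ival B i\<close>, about \<open>p\<close> times this value, and the value is
  close to \<open>r\<close>. Uniformity in \<open>r\<close> comes from absorbing finitely many
  exceptions into constants.\<close>

lemma records_below_asymptotics:
  fixes p \<delta> :: real
  assumes B: "rows_unbounded B" and p: "0 \<le> p" "p \<le> 1"
    and N: "(\<lambda>m. real (card {l \<in> {1..m}. record_col B l}) / real m) \<longlonglongrightarrow> p"
    and I: "\<And>\<epsilon>. 0 < \<epsilon> \<Longrightarrow> \<forall>\<^sub>F n in sequentially. real (Ival B n) \<le> (1 + \<epsilon>) * real n"
    and \<delta>: "0 < \<delta>"
  shows "\<forall>\<^sub>F n in sequentially. \<forall>r\<in>{1..n}.
           \<bar>real (records_below (map (Perm_n B n) [1..<Suc n]) r) - p * real r\<bar> \<le> \<delta> * real n"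
proof -
  define N' where "N' m = card {l \<in> {1..m}. record_col B l}" for m
  \<comment> \<open>The final error is \<open>3 * \<eta> * real n\<close> plus a constant, so
    \<open>\<delta> / 6\<close> uses half of \<open>\<delta>\<close>. The cap 1 allows
    \<open>\<eta> * \<eta>\<close> to be replaced by \<open>\<eta>\<close>.\<close>
  define \<eta> where "\<eta> = min 1 (\<delta> / 6)"
  have \<eta>: "0 < \<eta>" "\<eta> \<le> 1" "\<eta> \<le> \<delta> / 6" using \<delta> by (auto simp: \<eta>_def)
  obtain m0 where m0: "\<And>m. m \<ge> m0 \<Longrightarrow> \<bar>real (N' m) / real m - p\<bar> < \<eta>"
    using LIMSEQ_D[OF N, of \<eta>] \<eta> unfolding N'_def by auto
  have N'_le: "N' m \<le> m" for m
  proof -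
    have "N' m \<le> card {1..m}"
      unfolding N'_def by (rule card_mono) auto
    then show ?thesis by simp
  qed
  \<comment> \<open>For small \<open>m\<close> both quantities lie between 0 and \<open>m0\<close>,
    which the additive constant covers.\<close>
  have N_bound: "\<bar>real (N' m) - p * real m\<bar> \<le> \<eta> * real m + real m0" for m
  proof (cases "m \<ge> m0 \<and> m > 0")
    case True
    then have "\<bar>real (N' m) / real m - p\<bar> * real m \<le> \<eta> * real m"
      using m0[of m] by (intro mult_right_mono) auto
    moreover have "\<bar>real (N' m) / real m - p\<bar> * real m = \<bar>real (N' m) - p * real m\<bar>"
      using True by (simp add: abs_mult_pos left_diff_distrib)
    ultimately show ?thesis by simp
  next
    case False
    then have "m \<le> m0" by auto
    moreover have "0 \<le> p * real m" "p * real m \<le> real m"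
      using p by (auto simp: mult_left_le_one_le)
    moreover have "0 \<le> \<eta> * real m" using \<eta> by simp
    ultimately show ?thesis using N'_le[of m] by linarith
  qed
  obtain n0 where n0: "\<And>n. n \<ge> n0 \<Longrightarrow> real (Ival B n) \<le> (1 + \<eta>) * real n"
    using I[OF \<eta>(1)] by (auto simp: eventually_sequentially)
  \<comment> \<open>The sum dominates the finitely many early values that the asymptotic bound does
    not control.\<close>
  define c where "c = real (\<Sum>j<n0. Ival B j)"
  have c: "0 \<le> c" unfolding c_def by (rule of_nat_0_le_iff)
  have I_bound: "real (Ival B j) \<le> (1 + \<eta>) * real n + c" if "j \<le> n" for j n
  proof (cases "j < n0")
    case True
    then have "Ival B j \<le> (\<Sum>j<n0. Ival B j)"
      by (intro member_le_sum) auto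
    then have "real (Ival B j) \<le> c" unfolding c_def by (simp only: of_nat_le_iff)
    moreover have "0 \<le> (1 + \<eta>) * real n" using \<eta> by simp
    ultimately show ?thesis by linarith
  next
    case False
    then have "real (Ival B j) \<le> (1 + \<eta>) * real j" using n0 by auto
    also have "\<dots> \<le> (1 + \<eta>) * real n" using that \<eta> by (intro mult_left_mono) auto
    finally show ?thesis using c by linarith
  qed
  define d where "d = 2 * c + real m0 + 1"
  have "\<forall>\<^sub>F n in sequentially. d \<le> \<delta> / 2 * real n"
  proof -
    have "\<forall>\<^sub>F n in sequentially. 2 * d / \<delta> \<le> real n"
      using filterlim_real_sequentially unfolding filterlim_at_top by blast
    then show ?thesis
      by eventually_elim (use \<delta> in \<open>simp add: field_simps\<close>)
  qed
  then show ?thesis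
  proof eventually_elim
    case (elim n)
    show ?case
    proof
      fix r assume "r \<in> {1..n}"
      then obtain i where i: "i \<in> {1..n}" "r = Perm_n B n i"
        using Perm_n_image[OF B, of n] by (metis imageE)
      let ?v = "Ival B i"
      let ?K = "real (records_below (map (Perm_n B n) [1..<Suc n]) r)"
      \<comment> \<open>A common bound for the columns taken by the first \<open>n\<close>
        rows.\<close>
      define b where "b = nat \<lfloor>(1 + \<eta>) * real n + c\<rfloor>"
      have nn: "0 \<le> (1 + \<eta>) * real n + c" using \<eta> c by simp
      have b: "real b \<le> (1 + \<eta>) * real n + c"
        unfolding b_def using nn by simp
      have "Ival B j \<le> b" if "j \<in> {1..n}" for j
        unfolding b_def using I_bound[of j n] that by (simp add: le_nat_floor)
      from Perm_n_bounds[OF B i(1) this] have r: "r \<le> ?v" "?v + n \<le> r + b"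
        using i by auto
      have v1: "1 \<le> ?v" using Ival_props(1)[OF B] i by auto
      have "{1..<?v} = {1..?v - 1}" using v1 by auto
      then have K: "?K = real (N' (?v - 1))"
        using records_below_Perm_n[OF B i(1)] i(2) by (simp add: N'_def)
      have vb: "real ?v \<le> (1 + \<eta>) * real n + c" using I_bound[of i n] i by auto
      have "\<bar>?K - p * real (?v - 1)\<bar> \<le> \<eta> * real (?v - 1) + real m0"
        unfolding K by (rule N_bound)
      also have "\<eta> * real (?v - 1) \<le> \<eta> * ((1 + \<eta>) * real n + c)"
        using \<eta> vb by (intro mult_left_mono) auto
      also have "\<dots> = \<eta> * real n + \<eta> * (\<eta> * real n) + \<eta> * c"
        by (simp add: algebra_simps)
      also have "\<eta> * (\<eta> * real n) \<le> 1 * (\<eta> * real n)"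
        using \<eta> by (intro mult_right_mono) auto
      also have "\<eta> * c \<le> 1 * c"
        using \<eta> by (intro mult_right_mono) (auto simp: c)
      finally have 1: "\<bar>?K - p * real (?v - 1)\<bar> \<le> 2 * (\<eta> * real n) + c + real m0"
        by simp
      have "real b \<le> real n + \<eta> * real n + c"
        using b by (simp add: distrib_right)
      moreover have "real r \<le> real ?v" "real ?v + real n \<le> real r + real b" "real (?v - 1) = real ?v - 1"
        using r v1 by (simp_all add: of_nat_diff flip: of_nat_add)
      moreover have "0 \<le> \<eta> * real n" using \<eta> by simp
      ultimately have "\<bar>real (?v - 1) - real r\<bar> \<le> \<eta> * real n + c + 1"
        using c by linarith
      then have "\<bar>p\<bar> * \<bar>real (?v - 1) - real r\<bar> \<le> 1 * (\<eta> * real n + c + 1)"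
        using p by (intro mult_mono) auto
      then have 2: "\<bar>p * real (?v - 1) - p * real r\<bar> \<le> \<eta> * real n + c + 1"
        by (simp only: right_diff_distrib[symmetric] abs_mult mult_1)
      have "\<bar>?K - p * real r\<bar> \<le> \<bar>?K - p * real (?v - 1)\<bar> + \<bar>p * real (?v - 1) - p * real r\<bar>"
        by (rule order.trans[OF _ abs_triangle_ineq]) simp
      also have "\<dots> \<le> 2 * (\<eta> * real n) + c + real m0 + (\<eta> * real n + c + 1)"
        by (rule add_mono[OF 1 2])
      also have "\<dots> = 3 * (\<eta> * real n) + d"
        unfolding d_def by (simp only: algebra_simps)
      also have "\<dots> \<le> 3 * (\<delta> / 6 * real n) + \<delta> / 2 * real n"
        using elim \<eta> by (intro add_mono mult_left_mono mult_right_mono) auto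
      finally show "\<bar>?K - p * real r\<bar> \<le> \<delta> * real n" by simp
    qed
  qed
qed

lemma bst_n_GHP_tendsto:
  fixes p :: real
  assumes B: "rows_unbounded B" and p: "0 < p" "p \<le> 1"
    and N: "(\<lambda>m. real (card {l \<in> {1..m}. record_col B l}) / real m) \<longlonglongrightarrow> p"
    and I: "\<And>\<epsilon>. 0 < \<epsilon> \<Longrightarrow> \<forall>\<^sub>F n in sequentially. real (Ival B n) \<le> (1 + \<epsilon>) * real n"
  shows "(\<lambda>n. d_GHP (bst_n B n) (\<lambda>u v. real (graph_dist (bst_n B n) u v) / (p * real n))
            (uniform_count_measure (bst_n B n))
            {0..1::real} (\<lambda>x y. \<bar>x - y\<bar>) (restrict_space lborel {0..1::real})) \<longlonglongrightarrow> 0"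
    (is "?G \<longlonglongrightarrow> 0")
proof (rule LIMSEQ_I)
  fix e :: real assume e: "0 < e"
  define k where "k = 4 / p\<^sup>2 + 2 / p"
  have k: "0 < k" using p by (simp add: k_def add_pos_pos)
  \<comment> \<open>Leaves half of \<open>e\<close> to the term of order
    \<open>1 / real n\<close>.\<close>
  define \<delta> where "\<delta> = e / (2 * k)"
  have \<delta>: "0 < \<delta>" "\<delta> * k = e / 2" using e k by (auto simp: \<delta>_def)
  have "(\<lambda>n. (2 / p + 2) / real n) \<longlonglongrightarrow> 0" by (rule lim_const_over_n)
  then have "\<forall>\<^sub>F n in sequentially. (2 / p + 2) / real n < e / 2"
    using e by (intro order_tendstoD) auto
  moreover have "\<forall>\<^sub>F n in sequentially. \<forall>r\<in>{1..n}.
      \<bar>real (records_below (map (Perm_n B n) [1..<Suc n]) r) - p * real r\<bar> \<le> \<delta> * real n"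
    by (rule records_below_asymptotics[OF B less_imp_le[OF p(1)] p(2) N I \<delta>(1)])
  \<comment> \<open>Excludes the empty tree at \<open>n = 0\<close>.\<close>
  moreover note eventually_gt_at_top[of "0::nat"]
  ultimately
  have "\<forall>\<^sub>F n in sequentially. norm (?G n - 0) < e"
  proof eventually_elim
    case (elim n)
    let ?L = "map (Perm_n B n) [1..<Suc n]"
    have L: "distinct ?L" "set ?L = {1..n}"
      using inj_on_Perm_n[OF B, of n] Perm_n_image[OF B, of n]
      by (auto simp: distinct_map atLeastLessThanSuc_atLeastAtMost simp del: upt_Suc)
    have K: "\<bar>real (records_below ?L r) - p * real r\<bar> \<le> \<delta> * real n" if "r \<in> {1..n}" for r
      using elim(2) that by blast
    have "0 \<le> ?G n"
      unfolding bst_n_def by (rule d_GHP_bst_bounds(1)[where \<delta> = \<delta>, OF elim(3) L p(1) K])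
    moreover have "?G n \<le> \<delta> * k + (2 / p + 2) / real n"
      unfolding bst_n_def k_def by (rule d_GHP_bst_bounds(2)[where \<delta> = \<delta>, OF elim(3) L p(1) K])
    ultimately show ?case using elim(1) \<delta>(2) unfolding real_norm_def by linarith
  qed
  then show "\<exists>no. \<forall>n\<ge>no. norm (?G n - 0) < e"
    by (simp add: eventually_sequentially)
qed

section \<open>Almost sure asymptotics\<close>

lemma prob_space_bern_model: "prob_space (bern_model q)"
  unfolding bern_model_def by (intro prob_space_PiM) (rule prob_space_measure_pmf)

lemma space_bern_model [simp]: "space (bern_model q) = UNIV"
  by (simp add: bern_model_def space_PiM)

lemma UNIV_bern_model: "UNIV \<in> sets (bern_model q)"
  using sets.top[of "bern_model q"] by simp

lemma measurable_bern_model_entry [measurable]: "(\<lambda>B. B x) \<in> bern_model q \<rightarrow>\<^sub>M count_space UNIV"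
proof -
  have "(\<lambda>B. B x) \<in> bern_model q \<rightarrow>\<^sub>M measure_pmf (bernoulli_pmf (1 - q))"
    unfolding bern_model_def by (rule measurable_component_singleton) simp
  then show ?thesis by simp
qed

lemma distr_bern_model_entry:
  "distr (bern_model q) (measure_pmf (bernoulli_pmf (1 - q))) (\<lambda>B. B x) = measure_pmf (bernoulli_pmf (1 - q))"
  unfolding bern_model_def by (rule distr_PiM_component) (auto intro: prob_space_measure_pmf)

text \<open>The joint law of the coordinates is the product measure itself.\<close>

lemma indep_vars_bern_model:
  "prob_space.indep_vars (bern_model q) (\<lambda>_. measure_pmf (bernoulli_pmf (1 - q))) (\<lambda>x B. B x) UNIV"
proof -
  interpret prob_space "bern_model q" by (rule prob_space_bern_model)
  have "random_variable (measure_pmf (bernoulli_pmf (1 - q))) (\<lambda>B. B x)" for x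
    by simp
  moreover have "distr (bern_model q) (\<Pi>\<^sub>M x\<in>UNIV. measure_pmf (bernoulli_pmf (1 - q))) (\<lambda>B. \<lambda>x\<in>UNIV. B x)
      = (\<Pi>\<^sub>M x\<in>UNIV. distr (bern_model q) (measure_pmf (bernoulli_pmf (1 - q))) (\<lambda>B. B x))"
    by (simp add: distr_bern_model_entry restrict_UNIV distr_id flip: bern_model_def)
  ultimately show ?thesis
    by (subst indep_vars_iff_distr_eq_PiM) auto
qed

lemma sets_entries_False: "{B. \<forall>x\<in>J. \<not> B x} \<in> sets (bern_model q)"
proof -
  have "{B \<in> space (bern_model q). \<forall>x. x \<in> J \<longrightarrow> \<not> B x} \<in> sets (bern_model q)"
    by measurable
  then show ?thesis by (simp add: Ball_def)
qed

section \<open>Independence of functions of disjoint sets of entries\<close>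

text \<open>A pointwise form of dependence that can be checked without sub-sigma-algebras.\<close>

definition depends_on :: "'i set \<Rightarrow> (('i \<Rightarrow> 'a) \<Rightarrow> 'b) \<Rightarrow> bool" where
  "depends_on A f \<longleftrightarrow> (\<forall>B C. (\<forall>x\<in>A. B x = C x) \<longrightarrow> f B = f C)"

lemma depends_onD: "depends_on A f \<Longrightarrow> (\<And>x. x \<in> A \<Longrightarrow> B x = C x) \<Longrightarrow> f B = f C"
  by (auto simp: depends_on_def)

lemma expectation_mult_depends_on:
  fixes f g :: "(nat \<times> nat \<Rightarrow> bool) \<Rightarrow> real"
  assumes dep: "depends_on A f" "depends_on A' g" and disj: "A \<inter> A' = {}"
    and int: "integrable (bern_model q) f" "integrable (bern_model q) g"
  shows "(\<integral>B. f B * g B \<partial>bern_model q) = (\<integral>B. f B \<partial>bern_model q) * (\<integral>B. g B \<partial>bern_model q)"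
proof -
  interpret prob_space "bern_model q" by (rule prob_space_bern_model)
  let ?N = "measure_pmf (bernoulli_pmf (1 - q))"
  \<comment> \<open>Padding with \<open>False\<close> outside \<open>S\<close> is invisible to a
    function that depends on \<open>S\<close> only, so \<open>f\<close> and \<open>g\<close> factor
    through restrictions, which are independent.\<close>
  define extend where "extend S = (\<lambda>B x. if x \<in> S then B x else False)" for S :: "(nat \<times> nat) set"
  have ext_meas: "extend S \<in> (\<Pi>\<^sub>M x\<in>S. ?N) \<rightarrow>\<^sub>M bern_model q" for S
    unfolding bern_model_def extend_def
  proof (rule measurable_PiM_single')
    fix x :: "nat \<times> nat"
    show "(\<lambda>B. if x \<in> S then B x else False) \<in> (\<Pi>\<^sub>M x\<in>S. ?N) \<rightarrow>\<^sub>M ?N"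
      using measurable_component_singleton[of x S "\<lambda>_. ?N"] by (cases "x \<in> S") simp_all
  qed auto
  have "indep_var (\<Pi>\<^sub>M x\<in>A. ?N) (\<lambda>B. restrict B A) (\<Pi>\<^sub>M x\<in>A'. ?N) (\<lambda>B. restrict B A')"
    using indep_var_restrict[OF indep_vars_bern_model disj] by simp
  then have "indep_var borel ((f \<circ> extend A) \<circ> (\<lambda>B. restrict B A)) borel ((g \<circ> extend A') \<circ> (\<lambda>B. restrict B A'))"
    by (rule indep_var_compose) (rule measurable_comp[OF ext_meas] int[THEN borel_measurable_integrable])+
  moreover have "(f \<circ> extend A) \<circ> (\<lambda>B. restrict B A) = f"
  proof
    fix B show "((f \<circ> extend A) \<circ> (\<lambda>B. restrict B A)) B = f B"
      unfolding comp_def by (rule depends_onD[OF dep(1)]) (simp add: extend_def)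
  qed
  moreover have "(g \<circ> extend A') \<circ> (\<lambda>B. restrict B A') = g"
  proof
    fix B show "((g \<circ> extend A') \<circ> (\<lambda>B. restrict B A')) B = g B"
      unfolding comp_def by (rule depends_onD[OF dep(2)]) (simp add: extend_def)
  qed
  ultimately show ?thesis
    using int by (intro indep_var_lebesgue_integral) simp_all
qed

text \<open>Lists of naturals are countable, so one may condition on the previous list. The general
  \<open>F\<close> covers truncated arrays too.\<close>

lemma measurable_Iseq:
  assumes [measurable]: "\<And>x. (\<lambda>\<omega>. F \<omega> x) \<in> N \<rightarrow>\<^sub>M count_space UNIV"
  shows "(\<lambda>\<omega>. Iseq (F \<omega>) n) \<in> N \<rightarrow>\<^sub>M count_space UNIV"
proof (induction n)
  case (Suc n)
  have "(\<lambda>\<omega>. l @ [LEAST j. 1 \<le> j \<and> j \<notin> set l \<and> F \<omega> (Suc n, j)]) \<in> N \<rightarrow>\<^sub>M count_space UNIV" for l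
  proof -
    have "(\<lambda>\<omega>. LEAST j. 1 \<le> j \<and> j \<notin> set l \<and> F \<omega> (Suc n, j)) \<in> N \<rightarrow>\<^sub>M count_space UNIV"
      by measurable
    then show ?thesis
      by (rule measurable_compose) simp
  qed
  then have "(\<lambda>\<omega>. Iseq (F \<omega>) n @ [LEAST j. 1 \<le> j \<and> j \<notin> set (Iseq (F \<omega>) n) \<and> F \<omega> (Suc n, j)])
      \<in> N \<rightarrow>\<^sub>M count_space UNIV"
    by (rule measurable_compose_countable[where
          f = "\<lambda>l \<omega>. l @ [LEAST j. 1 \<le> j \<and> j \<notin> set l \<and> F \<omega> (Suc n, j)]", OF _ Suc])
  then show ?case unfolding Iseq.simps .
qed simp

lemma measurable_Ival:
  assumes "\<And>x. (\<lambda>\<omega>. F \<omega> x) \<in> N \<rightarrow>\<^sub>M count_space UNIV"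
  shows "(\<lambda>\<omega>. Ival (F \<omega>) n) \<in> N \<rightarrow>\<^sub>M count_space UNIV"
  unfolding Ival_def by (rule measurable_compose[OF measurable_Iseq[OF assms]]) simp_all

lemma measurable_first_reach [measurable]:
  "(\<lambda>B. first_reach B m) \<in> bern_model q \<rightarrow>\<^sub>M count_space UNIV"
proof -
  have [measurable]: "(\<lambda>B. Ival (truncate_cols m B) i) \<in> bern_model q \<rightarrow>\<^sub>M count_space UNIV" for i
  proof (rule measurable_Ival)
    fix x show "(\<lambda>B. truncate_cols m B x) \<in> bern_model q \<rightarrow>\<^sub>M count_space UNIV"
      unfolding truncate_cols_def by (cases x) simp
  qed
  show ?thesis
    unfolding first_reach_def by measurable
qed

lemma measurable_record_col [measurable]:
  "(\<lambda>B. record_col B m) \<in> bern_model q \<rightarrow>\<^sub>M count_space UNIV"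
  unfolding record_col_def
  by (rule measurable_compose_countable[where f = "\<lambda>i B. B (i, m)", OF _ measurable_first_reach]) simp

text \<open>Truncation overwrites all columns from \<open>m\<close> on, so arrays agreeing before
  \<open>m\<close> have equal truncations.\<close>

lemma depends_on_first_reach: "depends_on {x. snd x < m} (\<lambda>B. first_reach B m)"
  unfolding depends_on_def
proof (intro allI impI)
  fix B C :: "nat \<times> nat \<Rightarrow> bool" assume "\<forall>x\<in>{x. snd x < m}. B x = C x"
  then have "truncate_cols m B = truncate_cols m C"
    by (auto simp: truncate_cols_def fun_eq_iff) (meson not_le)+
  then show "first_reach B m = first_reach C m"
    by (simp add: first_reach_def)
qed

lemma depends_on_record_col: "depends_on {x. snd x \<le> m} (\<lambda>B. record_col B m)"
  unfolding depends_on_def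
proof (intro allI impI)
  fix B C :: "nat \<times> nat \<Rightarrow> bool" assume BC: "\<forall>x\<in>{x. snd x \<le> m}. B x = C x"
  then have "first_reach B m = first_reach C m"
    by (intro depends_onD[OF depends_on_first_reach]) auto
  then show "record_col B m = record_col C m"
    using BC by (simp add: record_col_def)
qed

definition record_count :: "(nat \<times> nat \<Rightarrow> bool) \<Rightarrow> nat \<Rightarrow> nat" where
  "record_count B m = card {l \<in> {1..m}. record_col B l}"

lemma record_count_Suc: "record_count B (Suc m) = record_count B m + of_bool (record_col B (Suc m))"
proof -
  have "{l \<in> {1..Suc m}. record_col B l} =
      (if record_col B (Suc m) then insert (Suc m) {l \<in> {1..m}. record_col B l} else {l \<in> {1..m}. record_col B l})"
    by (auto simp: le_Suc_eq)
  then show ?thesis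
    by (simp add: record_count_def)
qed

lemma record_count_0 [simp]: "record_count B 0 = 0"
  by (simp add: record_count_def)

lemma record_count_le: "record_count B m \<le> m"
  by (induction m) (auto simp: record_count_Suc)

lemma measurable_record_count [measurable]:
  "(\<lambda>B. record_count B m) \<in> bern_model q \<rightarrow>\<^sub>M count_space UNIV"
  by (induction m) (simp_all add: record_count_Suc)

lemma depends_on_record_count: "depends_on {x. snd x \<le> m} (\<lambda>B. record_count B m)"
proof (induction m)
  case (Suc m)
  show ?case
    unfolding depends_on_def
  proof (intro allI impI)
    fix B C :: "nat \<times> nat \<Rightarrow> bool" assume BC: "\<forall>x\<in>{x. snd x \<le> Suc m}. B x = C x"
    have "record_count B m = record_count C m"
      by (rule depends_onD[OF Suc]) (use BC in auto)
    moreover have "record_col B (Suc m) = record_col C (Suc m)"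
      by (rule depends_onD[OF depends_on_record_col]) (use BC in auto)
    ultimately show "record_count B (Suc m) = record_count C (Suc m)"
      by (simp add: record_count_Suc)
  qed
qed (simp add: depends_on_def)

section \<open>Law of large numbers for the record columns\<close>

context
  fixes q :: real
  assumes q: "0 \<le> q" "q < 1"
begin

interpretation prob_space "bern_model q" by (rule prob_space_bern_model)

lemma expectation_entry:
  "expectation (\<lambda>B. f (B x)) = (1 - q) * f True + q * f False" for f :: "bool \<Rightarrow> real"
proof -
  have "expectation (\<lambda>B. f (B x)) =
      (\<integral>b. f b \<partial>distr (bern_model q) (measure_pmf (bernoulli_pmf (1 - q))) (\<lambda>B. B x))"
    by (rule integral_distr[symmetric]) simp_all
  then show ?thesis
    using q by (simp add: distr_bern_model_entry mult.commute)
qed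

text \<open>Given the columns before \<open>m + 1\<close>, the entry deciding whether \<open>m + 1\<close> is a record value is
  a fresh Bernoulli variable.\<close>
lemma record_count_mgf:
  "expectation (\<lambda>B. exp (s * real (record_count B m))) = ((1 - q) * exp s + q) ^ m"
proof (induction m)
  case (Suc m)
  \<comment> \<open>The row of the deciding entry is random, so split by its value \<open>t\<close>:
    then \<open>?f t\<close> involves columns up to \<open>m\<close> only, and \<open>?g t\<close>
    the single entry \<open>(t, Suc m)\<close>.\<close>
  let ?f = "\<lambda>t B. exp (s * real (record_count B m)) * of_bool (first_reach B (Suc m) = t)"
  let ?g = "\<lambda>t B. exp (s * of_bool (B (t, Suc m)))"
  have bf: "\<bar>?f t B\<bar> \<le> exp (\<bar>s\<bar> * real m)" for t B
  proof -
    have "s * real (record_count B m) \<le> \<bar>s\<bar> * real m"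
      using record_count_le[of B m] by (intro mult_mono) auto
    then show ?thesis by (simp add: of_bool_def)
  qed
  have bg: "\<bar>?g t B\<bar> \<le> exp \<bar>s\<bar>" for t B
    by (cases "B (t, Suc m)") auto
  have intf: "integrable (bern_model q) (?f t)" for t
    by (rule integrable_const_bound[of _ "exp (\<bar>s\<bar> * real m)"]) (use bf in auto)
  have intg: "integrable (bern_model q) (?g t)" for t
    by (rule integrable_const_bound[of _ "exp \<bar>s\<bar>"]) (use bg in auto)
  have intfg: "integrable (bern_model q) (\<lambda>B. ?f t B * ?g t B)" for t
  proof (rule integrable_const_bound[of _ "exp (\<bar>s\<bar> * real m) * exp \<bar>s\<bar>"])
    show "AE B in bern_model q. norm (?f t B * ?g t B) \<le> exp (\<bar>s\<bar> * real m) * exp \<bar>s\<bar>"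
      unfolding real_norm_def abs_mult[of "?f t _"] by (intro AE_I2 mult_mono bf bg) auto
  qed simp
  have step: "expectation (\<lambda>B. ?f t B * ?g t B) = expectation (?f t) * ((1 - q) * exp s + q)" for t
  proof -
    have df: "depends_on {x. snd x \<le> m} (?f t)"
      unfolding depends_on_def
    proof (intro allI impI)
      fix B C :: "nat \<times> nat \<Rightarrow> bool" assume BC: "\<forall>x\<in>{x. snd x \<le> m}. B x = C x"
      have "record_count B m = record_count C m"
        by (rule depends_onD[OF depends_on_record_count]) (use BC in auto)
      moreover have "first_reach B (Suc m) = first_reach C (Suc m)"
        by (rule depends_onD[OF depends_on_first_reach]) (use BC in auto)
      ultimately show "?f t B = ?f t C" by simp
    qed
    have dg: "depends_on {(t, Suc m)} (?g t)"
      by (simp add: depends_on_def)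
    have "expectation (\<lambda>B. ?f t B * ?g t B) = expectation (?f t) * expectation (?g t)"
      by (rule expectation_mult_depends_on[OF df dg _ intf intg]) auto
    also have "expectation (?g t) = (1 - q) * exp s + q"
      using expectation_entry[of "\<lambda>b. exp (s * of_bool b)" "(t, Suc m)"] by simp
    finally show ?thesis .
  qed
  have pick: "(\<Sum>t\<in>{1..Suc m}. ?f t B * h t) = exp (s * real (record_count B m)) * h (first_reach B (Suc m))"
    for B and h :: "nat \<Rightarrow> real"
  proof -
    have "(\<Sum>t\<in>{1..Suc m}. ?f t B * h t) =
        (\<Sum>t\<in>{1..Suc m}. if t = first_reach B (Suc m) then exp (s * real (record_count B m)) * h t else 0)"
      by (intro sum.cong) auto
    then show ?thesis
      using first_reach_range[of "Suc m" B] by (simp add: sum.delta)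
  qed
  have "expectation (\<lambda>B. exp (s * real (record_count B (Suc m)))) =
      expectation (\<lambda>B. \<Sum>t\<in>{1..Suc m}. ?f t B * ?g t B)"
    by (rule Bochner_Integration.integral_cong)
      (auto simp only: pick record_count_Suc record_col_def of_nat_add of_nat_of_bool distrib_left exp_add)
  also have "\<dots> = (\<Sum>t\<in>{1..Suc m}. expectation (?f t) * ((1 - q) * exp s + q))"
    using intfg step by (subst Bochner_Integration.integral_sum) auto
  also have "\<dots> = expectation (\<lambda>B. \<Sum>t\<in>{1..Suc m}. ?f t B) * ((1 - q) * exp s + q)"
    using intf by (subst Bochner_Integration.integral_sum) (auto simp only: sum_distrib_right)
  also have "expectation (\<lambda>B. \<Sum>t\<in>{1..Suc m}. ?f t B) = expectation (\<lambda>B. exp (s * real (record_count B m)))"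
    using pick[of _ "\<lambda>_. 1"] by (intro Bochner_Integration.integral_cong) (auto simp only: mult_1_right)
  finally show ?case
    using Suc by simp
qed (use prob_space in simp)

text \<open>Hoeffding's bound for a Bernoulli variable. For negative \<open>s\<close>, factoring out
  \<open>exp s\<close> exchanges the roles of success and failure and reduces to a positive
  argument.\<close>

lemma bernoulli_mgf_le: "(1 - q) * exp s + q \<le> exp (s * (1 - q) + s\<^sup>2 / 8)"
proof -
  have nonneg: "1 + p * (exp h - 1) \<le> exp (h * p + h\<^sup>2 / 8)" if "0 \<le> h" "0 \<le> p" for h p :: real
  proof -
    have pos: "0 < 1 + p * (exp h - 1)"
      using that by (intro add_pos_nonneg mult_nonneg_nonneg) auto
    have "ln (1 + p * (exp h - 1)) \<le> h * p + h\<^sup>2 / 8"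
      using Hoeffdings_lemma_aux[OF that] by simp
    then show ?thesis using pos by (metis exp_le_cancel_iff exp_ln)
  qed
  show ?thesis
  proof (cases "0 \<le> s")
    case True
    then show ?thesis using nonneg[of s "1 - q"] q by (simp add: algebra_simps)
  next
    case False
    have "(1 - q) * exp s + q = exp s * (1 + q * (exp (- s) - 1))"
      by (simp add: algebra_simps exp_minus)
    also have "\<dots> \<le> exp s * exp (- s * q + (- s)\<^sup>2 / 8)"
      using False q by (intro mult_left_mono nonneg) auto
    also have "\<dots> = exp (s * (1 - q) + s\<^sup>2 / 8)"
      by (simp add: algebra_simps flip: exp_add)
    finally show ?thesis .
  qed
qed

lemma record_count_tail:
  assumes e: "0 < e"
  shows "prob {B. \<bar>real (record_count B m) - (1 - q) * real m\<bar> \<ge> e * real m} \<le> 2 * exp (- 2 * e\<^sup>2) ^ m"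
proof -
  let ?p = "1 - q"
  let ?S = "\<lambda>B. real (record_count B m)"
  let ?up = "{B. ?S B \<ge> (?p + e) * real m}" and ?lo = "{B. ?S B \<le> (?p - e) * real m}"
  have int: "integrable (bern_model q) (\<lambda>B. exp (s * ?S B))" for s
  proof (rule integrable_const_bound[of _ "exp (\<bar>s\<bar> * real m)"])
    have "s * ?S B \<le> \<bar>s\<bar> * real m" for B
      using record_count_le[of B m] by (intro mult_mono) auto
    then show "AE B in bern_model q. norm (exp (s * ?S B)) \<le> exp (\<bar>s\<bar> * real m)"
      by simp
  qed simp
  have mgf: "expectation (\<lambda>B. exp (s * ?S B)) \<le> exp (s * ?p + s\<^sup>2 / 8) ^ m" for s
    unfolding record_count_mgf using q by (intro power_mono bernoulli_mgf_le) auto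
  \<comment> \<open>\<open>s = 4 * e\<close> minimizes \<open>- s * e + s\<^sup>2 / 8\<close>, with
    value \<open>- 2 * e\<^sup>2\<close>. The lower tail uses its negative.\<close>
  have s: "0 < 4 * e" using e by simp
  have "prob ?up \<le> exp (- (4 * e) * ((?p + e) * real m)) * expectation (\<lambda>B. exp (4 * e * ?S B))"
    using Chernoff_ineq_ge[OF s, of UNIV ?S "(?p + e) * real m"] int[of "4 * e"]
    by (simp add: set_integrable_def set_lebesgue_integral_def UNIV_bern_model)
  also have "\<dots> \<le> exp (- (4 * e) * ((?p + e) * real m)) * exp (4 * e * ?p + (4 * e)\<^sup>2 / 8) ^ m"
    by (intro mult_left_mono mgf) auto
  also have "\<dots> = exp (- 2 * e\<^sup>2) ^ m"
    by (simp add: algebra_simps power2_eq_square flip: exp_add exp_of_nat_mult)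
  finally have up: "prob ?up \<le> exp (- 2 * e\<^sup>2) ^ m" .
  have "prob ?lo \<le> exp (4 * e * ((?p - e) * real m)) * expectation (\<lambda>B. exp (- (4 * e) * ?S B))"
    using Chernoff_ineq_le[OF s, of UNIV ?S "(?p - e) * real m"] int[of "- (4 * e)"]
    by (simp add: set_integrable_def set_lebesgue_integral_def UNIV_bern_model)
  also have "\<dots> \<le> exp (4 * e * ((?p - e) * real m)) * exp (- (4 * e) * ?p + (- (4 * e))\<^sup>2 / 8) ^ m"
    by (intro mult_left_mono mgf) auto
  also have "\<dots> = exp (- 2 * e\<^sup>2) ^ m"
    by (simp add: algebra_simps power2_eq_square flip: exp_add exp_of_nat_mult)
  finally have lo: "prob ?lo \<le> exp (- 2 * e\<^sup>2) ^ m" .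
  have [measurable]: "?up \<in> events" "?lo \<in> events"
    using measurable_sets[of "\<lambda>B. ?S B" "bern_model q" borel "{(?p + e) * real m..}"]
      measurable_sets[of "\<lambda>B. ?S B" "bern_model q" borel "{..(?p - e) * real m}"]
    by (auto simp: vimage_def)
  have "{B. \<bar>?S B - ?p * real m\<bar> \<ge> e * real m} \<subseteq> ?up \<union> ?lo"
    by (auto simp: algebra_simps abs_if split: if_splits)
  then have "prob {B. \<bar>?S B - ?p * real m\<bar> \<ge> e * real m} \<le> prob (?up \<union> ?lo)"
    by (intro finite_measure_mono) auto
  also have "\<dots> \<le> prob ?up + prob ?lo"
    by (intro measure_Un_le) auto
  also have "\<dots> \<le> 2 * exp (- 2 * e\<^sup>2) ^ m"
    using up lo by simp
  finally show ?thesis .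
qed

lemma AE_record_count:
  "AE B in bern_model q. (\<lambda>m. real (record_count B m) / real m) \<longlonglongrightarrow> 1 - q"
proof -
  have ev: "AE B in bern_model q. \<forall>\<^sub>F m in sequentially. \<bar>real (record_count B m) - (1 - q) * real m\<bar> < e * real m"
    if e: "0 < e" for e
  proof -
    let ?A = "\<lambda>m. {B. \<bar>real (record_count B m) - (1 - q) * real m\<bar> \<ge> e * real m}"
    have meas: "?A m \<in> events" for m
      using measurable_sets[of "\<lambda>B. \<bar>real (record_count B m) - (1 - q) * real m\<bar>" "bern_model q" borel "{e * real m..}"]
      by (auto simp: vimage_def)
    have "summable (\<lambda>m. 2 * exp (- 2 * e\<^sup>2) ^ m)"
      using e by (intro summable_mult summable_geometric) auto
    then have "summable (\<lambda>m. prob (?A m))"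
      by (rule summable_comparison_test') (use record_count_tail[OF e] in auto)
    from borel_cantelli_AE1[OF meas _ this] show ?thesis
      by (rule AE_mp) (auto simp: not_le emeasure_eq_measure elim!: eventually_mono)
  qed
  \<comment> \<open>Countably many tolerances suffice, so the exceptional null sets can be
    united.\<close>
  have "AE B in bern_model q. \<forall>k. \<forall>\<^sub>F m in sequentially.
      \<bar>real (record_count B m) - (1 - q) * real m\<bar> < 1 / real (Suc k) * real m"
    unfolding AE_all_countable by (intro allI ev) simp
  then show ?thesis
  proof (rule AE_mp, intro AE_I2 impI)
    fix B assume B: "\<forall>k. \<forall>\<^sub>F m in sequentially.
      \<bar>real (record_count B m) - (1 - q) * real m\<bar> < 1 / real (Suc k) * real m"
    show "(\<lambda>m. real (record_count B m) / real m) \<longlonglongrightarrow> 1 - q"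
    proof (rule tendstoI)
      fix e :: real assume "0 < e"
      then obtain k where k: "1 / real (Suc k) < e"
        using reals_Archimedean[of e] by (auto simp: inverse_eq_divide)
      from B[rule_format, of k] eventually_gt_at_top[of 0]
      show "\<forall>\<^sub>F m in sequentially. dist (real (record_count B m) / real m) (1 - q) < e"
      proof eventually_elim
        case (elim m)
        have "dist (real (record_count B m) / real m) (1 - q) =
            \<bar>(real (record_count B m) - (1 - q) * real m) / real m\<bar>"
          using elim(2) by (simp add: dist_real_def diff_divide_distrib)
        also have "\<dots> = \<bar>real (record_count B m) - (1 - q) * real m\<bar> / real m"
          by simp
        also have "\<dots> < 1 / real (Suc k)"
          using elim by (simp add: pos_divide_less_eq)
        finally show ?case using k by simp
      qed
    qed
  qed
qed

section \<open>Growth of the chosen columns\<close>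

lemma prob_entries_False:
  assumes "finite J"
  shows "prob {B. \<forall>x\<in>J. \<not> B x} = q ^ card J"
proof -
  interpret P: product_prob_space "\<lambda>_. measure_pmf (bernoulli_pmf (1 - q))" "UNIV :: (nat \<times> nat) set"
    by unfold_locales
  have "emeasure (bern_model q) {B. \<forall>x\<in>J. \<not> B x} =
      emeasure (bern_model q) {B \<in> space (bern_model q). \<forall>x\<in>J. B x \<in> {False}}"
    by simp
  also have "\<dots> = (\<Prod>x\<in>J. emeasure (measure_pmf (bernoulli_pmf (1 - q))) {False})"
    unfolding bern_model_def using assms by (intro P.emeasure_PiM_Collect) auto
  also have "\<dots> = ennreal (q ^ card J)"
    using q by (simp add: emeasure_pmf_single ennreal_power)
  finally show ?thesis
    using q by (simp add: measure_def)
qed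

text \<open>A row without ones beyond \<open>N\<close> starts with \<open>g\<close> zeros there for
  every \<open>g\<close>, and this has probability \<open>q ^ g\<close>, which tends to 0.\<close>

lemma AE_rows_unbounded: "AE B in bern_model q. rows_unbounded B"
proof -
  have "AE B in bern_model q. \<exists>j>N. B (i, j)" for i N
  proof -
    let ?Z = "{B. \<forall>x\<in>Pair i ` {N<..}. \<not> B x}"
    have "prob ?Z \<le> q ^ g" for g
    proof -
      have "prob ?Z \<le> prob {B. \<forall>x\<in>Pair i ` {N<..N + g}. \<not> B x}"
        by (intro finite_measure_mono sets_entries_False) auto
      also have "\<dots> = q ^ g"
        by (subst prob_entries_False) (auto simp: card_image inj_on_def)
      finally show ?thesis .
    qed
    moreover have "(\<lambda>g. q ^ g) \<longlonglongrightarrow> 0"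
      using q by (intro LIMSEQ_power_zero) auto
    ultimately have "prob ?Z \<le> 0"
      by (intro LIMSEQ_le_const) auto
    then have "?Z \<in> null_sets (bern_model q)"
      using sets_entries_False by (intro null_setsI) (simp_all only: emeasure_eq_measure measure_le_0_iff ennreal_0)
    then show ?thesis
      by (rule AE_I') auto
  qed
  then show ?thesis
    unfolding rows_unbounded_def by (simp add: AE_all_countable)
qed

text \<open>Row \<open>n + 1\<close> is independent of the \<open>n\<close> positions taken before, and at least \<open>g\<close> of the first
  \<open>n + g\<close> positions are still free.\<close>
lemma Ival_tail:
  "prob {B. n + g < Ival B (Suc n)} \<le> q ^ g"
proof -
  \<comment> \<open>The occupied part of the window is a random set with finitely many possible
    values \<open>D\<close>; fixing it separates the first \<open>n\<close> rows from row
    \<open>Suc n\<close>.\<close>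
  let ?T = "\<lambda>B. {1..n + g} \<inter> set (Iseq B n)"
  let ?F = "\<lambda>D. {B. \<forall>x\<in>Pair (Suc n) ` ({1..n + g} - D). \<not> B x}"
  let ?f = "\<lambda>D B. of_bool (?T B = D) :: real"
  let ?g = "\<lambda>D. indicator (?F D) :: _ \<Rightarrow> real"
  note [measurable] = measurable_Iseq[of "\<lambda>B. B", OF measurable_bern_model_entry]
    measurable_Ival[of "\<lambda>B. B", OF measurable_bern_model_entry] sets_entries_False
  have cardT: "card (?T B) \<le> n" for B
  proof -
    have "card (?T B) \<le> card (set (Iseq B n))" by (intro card_mono) auto
    also have "\<dots> \<le> n" using card_length[of "Iseq B n"] by simp
    finally show ?thesis .
  qed
  have measf: "?f D \<in> borel_measurable (bern_model q)" for D
  proof -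
    have "(\<lambda>l. of_bool ({1..n + g} \<inter> set l = D) :: real) \<in> count_space UNIV \<rightarrow>\<^sub>M borel" by simp
    from measurable_compose[OF _ this, of "\<lambda>B. Iseq B n"] show ?thesis by simp
  qed
  have intf: "integrable (bern_model q) (?f D)" for D
    by (rule integrable_const_bound[of _ 1]) (use measf in auto)
  have intg: "integrable (bern_model q) (?g D)" for D
    by (rule integrable_const_bound[of _ 1]) (auto simp: indicator_def)
  have intfg: "integrable (bern_model q) (\<lambda>B. ?f D B * ?g D B)" for D
    by (rule integrable_const_bound[of _ 1]) (use measf in \<open>auto simp: indicator_def\<close>)
  have step: "expectation (\<lambda>B. ?f D B * ?g D B) \<le> expectation (?f D) * q ^ g"
    if D: "D \<in> Pow {1..n + g}" for D
  proof (cases "card D \<le> n")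
    case True
    have df: "depends_on {x. fst x \<le> n} (?f D)"
      unfolding depends_on_def
    proof (intro allI impI)
      fix B C :: "nat \<times> nat \<Rightarrow> bool" assume BC: "\<forall>x\<in>{x. fst x \<le> n}. B x = C x"
      have "k \<le> n \<Longrightarrow> Iseq B k = Iseq C k" for k
        using BC by (induction k) auto
      then show "?f D B = ?f D C" by simp
    qed
    have dg: "depends_on {x. fst x = Suc n} (?g D)"
      by (auto simp: depends_on_def indicator_def)
    have "expectation (\<lambda>B. ?f D B * ?g D B) = expectation (?f D) * expectation (?g D)"
      by (rule expectation_mult_depends_on[OF df dg _ intf intg]) auto
    also have "expectation (?g D) = q ^ card ({1..n + g} - D)"
      using prob_entries_False[of "Pair (Suc n) ` ({1..n + g} - D)"]
      by (simp add: card_image inj_on_def)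
    also have "card ({1..n + g} - D) = n + g - card D"
      using D by (subst card_Diff_subset) (auto intro: finite_subset)
    also have "q ^ (n + g - card D) \<le> q ^ g"
      using q True by (intro power_decreasing) auto
    finally show ?thesis
      by (simp add: mult_left_mono)
  next
    case False
    \<comment> \<open>Only \<open>n\<close> columns are taken, so a larger \<open>D\<close> never
      occurs.\<close>
    then have "?f D B = 0" for B
      using cardT[of B] by auto
    then show ?thesis by simp
  qed
  \<comment> \<open>If the new value lies beyond the window, every free column in it carries a zero
    in row \<open>Suc n\<close>.\<close>
  have le: "indicator {B. n + g < Ival B (Suc n)} B \<le> (\<Sum>D\<in>Pow {1..n + g}. ?f D B * ?g D B)" for B
  proof -
    have "(\<Sum>D\<in>Pow {1..n + g}. ?f D B * ?g D B) = (\<Sum>D\<in>Pow {1..n + g}. if D = ?T B then ?g D B else 0)"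
      by (intro sum.cong) auto
    also have "\<dots> = ?g (?T B) B"
      by (subst sum.delta) auto
    finally have eq: "(\<Sum>D\<in>Pow {1..n + g}. ?f D B * ?g D B) = ?g (?T B) B" .
    have "B \<in> ?F (?T B)" if "n + g < Ival B (Suc n)"
    proof -
      have False if j: "j \<in> {1..n + g} - ?T B" "B (Suc n, j)" for j
        using Ival_Suc_le[of j B n] j \<open>n + g < Ival B (Suc n)\<close> by (auto simp: set_Iseq)
      then show ?thesis by blast
    qed
    then show ?thesis
      unfolding eq by (auto simp: indicator_def)
  qed
  have ev: "{B. n + g < Ival B (Suc n)} \<in> events"
  proof -
    have "{B \<in> space (bern_model q). n + g < Ival B (Suc n)} \<in> events" by measurable
    then show ?thesis by simp
  qed
  have "prob {B. n + g < Ival B (Suc n)} = expectation (indicator {B. n + g < Ival B (Suc n)})"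
    using ev by simp
  also have "\<dots> \<le> expectation (\<lambda>B. \<Sum>D\<in>Pow {1..n + g}. ?f D B * ?g D B)"
  proof (rule integral_mono[OF _ _ le])
    show "integrable (bern_model q) (indicator {B. n + g < Ival B (Suc n)} :: _ \<Rightarrow> real)"
      using ev by (simp add: integrable_real_indicator emeasure_eq_measure)
    show "integrable (bern_model q) (\<lambda>B. \<Sum>D\<in>Pow {1..n + g}. ?f D B * ?g D B)"
      using intfg by (rule Bochner_Integration.integrable_sum)
  qed
  also have "\<dots> = (\<Sum>D\<in>Pow {1..n + g}. expectation (\<lambda>B. ?f D B * ?g D B))"
    using intfg by (subst Bochner_Integration.integral_sum) auto
  also have "\<dots> \<le> (\<Sum>D\<in>Pow {1..n + g}. expectation (?f D) * q ^ g)"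
    by (intro sum_mono step)
  also have "\<dots> = expectation (\<lambda>B. \<Sum>D\<in>Pow {1..n + g}. ?f D B) * q ^ g"
    using intf by (subst Bochner_Integration.integral_sum) (auto simp: sum_distrib_right)
  also have "(\<lambda>B. \<Sum>D\<in>Pow {1..n + g}. ?f D B) = (\<lambda>B. 1)"
  proof
    fix B
    have "(\<Sum>D\<in>Pow {1..n + g}. ?f D B) = (\<Sum>D\<in>Pow {1..n + g}. if D = ?T B then 1 else 0)"
      by (intro sum.cong) auto
    also have "\<dots> = 1"
      by (subst sum.delta) auto
    finally show "(\<Sum>D\<in>Pow {1..n + g}. ?f D B) = 1" .
  qed
  finally show ?thesis
    using prob_space by simp
qed

text \<open>With a gap proportional to \<open>n\<close> the tail probabilities are summable, and
  Borel-Cantelli applies.\<close>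

lemma AE_Ival_le:
  "AE B in bern_model q. \<forall>\<epsilon>>0. \<forall>\<^sub>F n in sequentially. real (Ival B n) \<le> (1 + \<epsilon>) * real n"
proof -
  note [measurable] = measurable_Ival[of "\<lambda>B. B", OF measurable_bern_model_entry]
  have ev: "AE B in bern_model q. \<forall>\<^sub>F n in sequentially. real (Ival B (Suc n)) \<le> (1 + \<epsilon>) * real n + 1"
    if e: "0 < \<epsilon>" for \<epsilon> :: real
  proof -
    \<comment> \<open>Lies strictly between 0 and 1 even for \<open>q = 0\<close>, so that its
      powers can be written with \<open>powr\<close> and real exponents.\<close>
    define r where "r = (1 + q) / 2"
    have r: "q \<le> r" "0 < r" "r < 1" using q by (auto simp: r_def)
    let ?g = "\<lambda>n. nat \<lceil>\<epsilon> * real n\<rceil>"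
    let ?A = "\<lambda>n. {B. n + ?g n < Ival B (Suc n)}"
    have meas: "?A n \<in> events" for n
    proof -
      have "{B \<in> space (bern_model q). n + ?g n < Ival B (Suc n)} \<in> events" by measurable
      then show ?thesis by simp
    qed
    have bound: "prob (?A n) \<le> (r powr \<epsilon>) ^ n" for n
    proof -
      have "prob (?A n) \<le> q ^ ?g n" by (rule Ival_tail)
      also have "\<dots> \<le> r ^ ?g n" using q r by (intro power_mono) auto
      also have "\<dots> = r powr real (?g n)" using r by (simp add: powr_realpow)
      also have "\<dots> \<le> r powr (\<epsilon> * real n)"
        using r by (intro powr_mono') linarith+
      also have "\<dots> = (r powr \<epsilon>) ^ n" using r by (simp add: powr_powr flip: powr_realpow)
      finally show ?thesis .
    qed
    have "r powr \<epsilon> < 1" using r e by (simp add: powr_def mult_pos_neg)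
    then have "summable (\<lambda>n. (r powr \<epsilon>) ^ n)"
      by (intro summable_geometric) auto
    then have "summable (\<lambda>n. prob (?A n))"
      by (rule summable_comparison_test') (use bound in auto)
    from borel_cantelli_AE1[OF meas _ this] show ?thesis
    proof (rule AE_mp)
      show "AE B in bern_model q. (\<forall>\<^sub>F n in sequentially. B \<in> space (bern_model q) - ?A n) \<longrightarrow>
          (\<forall>\<^sub>F n in sequentially. real (Ival B (Suc n)) \<le> (1 + \<epsilon>) * real n + 1)"
      proof (intro AE_I2 impI)
        fix B assume "\<forall>\<^sub>F n in sequentially. B \<in> space (bern_model q) - ?A n"
        then show "\<forall>\<^sub>F n in sequentially. real (Ival B (Suc n)) \<le> (1 + \<epsilon>) * real n + 1"
        proof eventually_elim
          case (elim n)
          then have "real (Ival B (Suc n)) \<le> real n + real (?g n)"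
            by (simp flip: of_nat_add)
          also have "real (?g n) \<le> \<epsilon> * real n + 1"
            using e by (simp add: of_nat_nat)
          finally show ?case by (simp add: distrib_right)
        qed
      qed
    qed (simp add: emeasure_eq_measure)
  qed
  have "AE B in bern_model q. \<forall>k. \<forall>\<^sub>F n in sequentially. real (Ival B (Suc n)) \<le> (1 + 1 / real (Suc k)) * real n + 1"
    unfolding AE_all_countable by (intro allI ev) simp
  then show ?thesis
  proof (rule AE_mp, intro AE_I2 impI allI)
    fix B :: "nat \<times> nat \<Rightarrow> bool" and \<epsilon> :: real
    assume B: "\<forall>k. \<forall>\<^sub>F n in sequentially. real (Ival B (Suc n)) \<le> (1 + 1 / real (Suc k)) * real n + 1"
      and "0 < \<epsilon>"
    then obtain k where k: "1 / real (Suc k) < \<epsilon>"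
      using reals_Archimedean[of \<epsilon>] by (auto simp: inverse_eq_divide)
    from B[rule_format, of k]
    \<comment> \<open>The extra 1 from rounding up the gap is absorbed by passing from
      \<open>n\<close> to \<open>Suc n\<close> on the right.\<close>
    have "\<forall>\<^sub>F n in sequentially. real (Ival B (Suc n)) \<le> (1 + \<epsilon>) * real (Suc n)"
    proof eventually_elim
      case (elim n)
      note elim
      also have "(1 + 1 / real (Suc k)) * real n \<le> (1 + \<epsilon>) * real n"
        using k by (intro mult_right_mono) auto
      also have "(1 + \<epsilon>) * real n + 1 \<le> (1 + \<epsilon>) * real (Suc n)"
        using \<open>0 < \<epsilon>\<close> by (simp add: algebra_simps)
      finally show ?case by simp
    qed
    then show "\<forall>\<^sub>F n in sequentially. real (Ival B n) \<le> (1 + \<epsilon>) * real n"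
      by (subst (asm) eventually_sequentially_Suc)
  qed
qed

end

theorem theorem1p4:
  fixes q :: real
  assumes "0 \<le> q" and "q < 1"
  shows "AE B in bern_model q.
    (\<lambda>n. d_GHP (bst_n B n)
                (\<lambda>u v. real (graph_dist (bst_n B n) u v) / ((1 - q) * real n))
                (uniform_count_measure (bst_n B n))
                {0..1::real} (\<lambda>x y. \<bar>x - y\<bar>) (restrict_space lborel {0..1::real}))
    \<longlonglongrightarrow> 0"
  \<comment> \<open>On the intersection of these three almost sure events the convergence is
    deterministic.\<close>
  using AE_rows_unbounded[OF assms] AE_record_count[OF assms] AE_Ival_le[OF assms]
proof eventually_elim
  case (elim B)
  show ?case
    by (rule bst_n_GHP_tendsto) (use elim assms in \<open>auto simp: record_count_def\<close>)
qed

end
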